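(* Let $a,b,k_1,k_2,k_3$ be positive integers, let $N=\mathrm{lcm}(a,b)$, and suppose $k=k_1+k_2+k_3$ is odd. Then \[\zeta_{a,b}(k_1,k_2,k_3)=\sum_{m,n>0}\frac{1}{m^{k_1}n^{k_2}(am+bn)^{k_3}}\] can be expressed as a $\mathbb{Q}$-linear combination of the numbers $\pi^{2n}C_{k-2n}(\tfrac{d}{N})$ and $\pi^{2n+1}S_{k-2n-1}(\tfrac{d}{N})$ with $0\le n\le \frac{k-3}{2}$ and $d\in\mathbb{Z}/N\mathbb{Z}$.
   Context: For an integer $k\ge2$ and $x\in\mathbb{R}$, the Clausen-type functions are $C_k(x)=\mathrm{Re}\,Li_k(e^{2\pi i x})=\sum_{m>0}\frac{\cos(2\pi m x)}{m^k}$ and $S_k(x)=\mathrm{Im}\,Li_k(e^{2\pi i x})=\sum_{m>0}\frac{\sin(2\pi m x)}{m^k}$, where $Li_k(z)=\sum_{m>0}z^m/m^k$. These depend only on $x$ modulo $1$, so $C_k(d/N)$, $S_k(d/N)$ are well defined for $d\in\mathbb{Z}/N\mathbb{Z}$. *)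

theory Defs
  imports "HOL-Analysis.Analysis"
begin

text \<open>The index \<open>m > 0\<close> of the series is written as \<open>Suc m\<close>. The polylogarithm is only used on
  the closed unit disc with \<open>k \<ge> 2\<close>, where its series converges absolutely.\<close>

definition polylog :: "nat \<Rightarrow> complex \<Rightarrow> complex" where
  "polylog k z = (\<Sum>m. z ^ Suc m / of_nat (Suc m) ^ k)"

definition clausen_C :: "nat \<Rightarrow> real \<Rightarrow> real" where
  "clausen_C k x = Re (polylog k (exp (2 * of_real pi * \<i> * of_real x)))"

definition clausen_S :: "nat \<Rightarrow> real \<Rightarrow> real" where
  "clausen_S k x = Im (polylog k (exp (2 * of_real pi * \<i> * of_real x)))"

lemma polylog_summable:
  assumes "k \<ge> 2" "norm z \<le> 1"
  shows "summable (\<lambda>m. z ^ Suc m / of_nat (Suc m) ^ k :: complex)"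
proof (rule summable_comparison_test)
  have "norm (z ^ Suc m / of_nat (Suc m) ^ k) \<le> inverse (real (Suc m) ^ k)" for m
  proof -
    have "norm z ^ Suc m \<le> 1"
      using assms(2) by (intro power_le_one) auto
    then show ?thesis
      by (simp add: norm_divide norm_power norm_mult divide_simps del: of_nat_Suc power_Suc)
  qed
  then show "\<exists>M. \<forall>m\<ge>M. norm (z ^ Suc m / of_nat (Suc m) ^ k) \<le> inverse (real (Suc m) ^ k)"
    by blast
  show "summable (\<lambda>m. inverse (real (Suc m) ^ k))"
    using inverse_power_summable[OF assms(1), where 'a = real]
    by (subst summable_Suc_iff)
qed

lemma exp_circle_power:
  "exp (2 * of_real pi * \<i> * of_real x) ^ m = cis (2 * pi * real m * x)"
  by (simp add: cis_conv_exp flip: exp_of_nat_mult) (simp add: algebra_simps)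

lemma clausen_sums:
  assumes "k \<ge> 2"
  shows "(\<lambda>m. cos (2 * pi * real (Suc m) * x) / real (Suc m) ^ k) sums clausen_C k x"
    and "(\<lambda>m. sin (2 * pi * real (Suc m) * x) / real (Suc m) ^ k) sums clausen_S k x"
proof -
  let ?z = "exp (2 * of_real pi * \<i> * of_real x)"
  have "norm ?z \<le> 1" by simp
  from summable_sums[OF polylog_summable[OF assms this]]
  have s: "(\<lambda>m. ?z ^ Suc m / of_nat (Suc m) ^ k) sums polylog k ?z"
    by (simp add: polylog_def)
  have t: "?z ^ Suc m / of_nat (Suc m) ^ k
      = cis (2 * pi * real (Suc m) * x) / of_real (real (Suc m) ^ k)" for m
    by (simp only: exp_circle_power of_real_power of_real_of_nat_eq)
  show "(\<lambda>m. cos (2 * pi * real (Suc m) * x) / real (Suc m) ^ k) sums clausen_C k x"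
    using sums_Re[OF s] unfolding t clausen_C_def Re_divide_of_real by simp
  show "(\<lambda>m. sin (2 * pi * real (Suc m) * x) / real (Suc m) ^ k) sums clausen_S k x"
    using sums_Im[OF s] unfolding t clausen_S_def Im_divide_of_real by simp
qed

definition zeta_ab :: "nat \<Rightarrow> nat \<Rightarrow> nat \<Rightarrow> nat \<Rightarrow> nat \<Rightarrow> real" where
  "zeta_ab a b k1 k2 k3 =
     (\<Sum>\<^sub>\<infinity>(m, n)\<in>{0<..} \<times> {0<..}. 1 / (real m ^ k1 * real n ^ k2 * real (a * m + b * n) ^ k3))"

text \<open>The value of \<open>zeta_ab\<close> is a genuine sum: the double series converges.\<close>

lemma zeta_ab_summable:
  assumes pos: "a > 0" "b > 0" "k1 > 0" "k2 > 0" "k3 > 0"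
  shows "(\<lambda>(m, n). 1 / (real m ^ k1 * real n ^ k2 * real (a * m + b * n) ^ k3))
           summable_on {0<..} \<times> {0<..}"
proof -
  define h where "h = (\<lambda>n. real n powr (-3/2))"
  have "summable h"
    unfolding h_def by (subst summable_real_powr_iff) auto
  then have "h summable_on UNIV"
    by (intro summable_nonneg_imp_summable_on) (auto simp: h_def)
  then have h: "h summable_on {0<..}"
    by (rule summable_on_subset_banach) auto
  have "(\<lambda>(m, n). h m * h n) summable_on {0<..} \<times> {0<..}"
  proof (rule summable_on_SigmaI)
    fix m
    show "((\<lambda>n. case (m, n) of (m, n) \<Rightarrow> h m * h n) has_sum h m * infsum h {0<..}) {0<..}"
      using has_sum_cmult_right[OF has_sum_infsum[OF h]] by simp
  next
    show "(\<lambda>m. h m * infsum h {0<..}) summable_on {0<..}"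
      by (rule summable_on_cmult_left[OF h])
  qed (auto simp: h_def)
  then show ?thesis
  proof (rule summable_on_comparison_test)
    fix p :: "nat \<times> nat" assume "p \<in> {0<..} \<times> {0<..}"
    then obtain m n where p: "p = (m, n)" and mn: "m > 0" "n > 0" by auto
    have h_eq: "h j = 1 / (real j * sqrt (real j))" if "j > 0" for j
    proof -
      have "real j powr (3/2) = real j powr (1 + 1/2)" by simp
      also have "\<dots> = real j * sqrt (real j)"
        using that by (simp only: powr_add powr_one powr_half_sqrt of_nat_0_le_iff)
      finally show ?thesis
        using powr_minus_divide[of "real j" "3/2"] by (simp add: h_def)
    qed
    have le: "sqrt (real m) * sqrt (real n) \<le> real (a * m + b * n)"
    proof -
      have "sqrt (real m) * sqrt (real n) = sqrt (real m * real n)"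
        by (simp add: real_sqrt_mult)
      also have "\<dots> \<le> (real m + real n) / 2"
        by (rule arith_geo_mean_sqrt) auto
      also have "\<dots> \<le> real (m + n)" by simp
      also have "m + n \<le> a * m + b * n"
        using pos by (intro add_mono) auto
      then have "real (m + n) \<le> real (a * m + b * n)" by linarith
      finally show ?thesis .
    qed
    have s1: "1 \<le> a * m + b * n" using pos mn by (simp add: Suc_le_eq)
    have "real m * real n * (sqrt (real m) * sqrt (real n))
        \<le> real m ^ k1 * real n ^ k2 * real (a * m + b * n) ^ k3"
    proof (intro mult_mono)
      show "real m \<le> real m ^ k1" "real n \<le> real n ^ k2"
        using mn pos by (auto intro!: self_le_power)
      have "real (a * m + b * n) \<le> real (a * m + b * n) ^ k3"
        using s1 pos by (intro self_le_power) linarith+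
      with le show "sqrt (real m) * sqrt (real n) \<le> real (a * m + b * n) ^ k3"
        by linarith
    qed auto
    then have "1 / (real m ^ k1 * real n ^ k2 * real (a * m + b * n) ^ k3)
        \<le> 1 / (real m * real n * (sqrt (real m) * sqrt (real n)))"
      using mn s1 by (intro divide_left_mono mult_pos_pos zero_less_power) (auto simp del: of_nat_add of_nat_mult)
    also have "\<dots> = h m * h n"
      using mn by (simp add: h_eq)
    finally show "(case p of (m, n) \<Rightarrow> 1 / (real m ^ k1 * real n ^ k2 * real (a * m + b * n) ^ k3))
        \<le> (case p of (m, n) \<Rightarrow> h m * h n)"
      by (simp add: p)
  qed (auto intro!: divide_nonneg_nonneg mult_nonneg_nonneg)
qed

end

theory Submission
  imports Defs
begin

text \<open>The summand \<open>g m n = 1 / (m^k1 n^k2 (am + bn)^k3)\<close> is odd on \<open>\<int> \<times> \<int>\<close>, so in the sum of \<open>g\<close> over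
  the half plane \<open>m > 0\<close> and that over the half plane \<open>n > 0\<close> the quadrants with \<open>mn < 0\<close> cancel,
  leaving \<open>2 \<zeta>\<^bsub>a,b\<^esub>\<close>. In the half plane \<open>m > 0\<close>, a partial fraction decomposition in \<open>n\<close> reduces the inner
  sum to symmetric sums of \<open>1 / n^j\<close> and \<open>1 / (am + bn)^j\<close> over all integers \<open>n\<close>. These are \<open>\<pi>^j\<close> times rational
  polynomials of parity \<open>j\<close> in \<open>cot (\<pi>am/b)\<close>, that is, \<open>\<pi>^j\<close> times rational combinations of
  \<open>cos (2\<pi>dam/b)\<close> for even \<open>j\<close> and of \<open>sin (2\<pi>dam/b)\<close> for odd \<open>j\<close>; summing over \<open>m\<close> yields Clausen values.
  The convention \<open>1 / 0 = 0\<close> silently drops the terms with \<open>m = 0\<close>, \<open>n = 0\<close> or \<open>am + bn = 0\<close>.\<close>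

section \<open>Symmetric sums over arithmetic progressions\<close>

text \<open>Pairing \<open>n\<close> with \<open>-1 - n\<close> exhausts the half-open range
  exactly. For the summand \<open>1 / (x + n) ^ j\<close> the two halves become, up to sign, series
  at \<open>x\<close> and at \<open>1 - x\<close>, the shape a reflection formula needs.\<close>

lemma sum_symmetric_int:
  "(\<Sum>n\<in>{-int M..<int M}. f n) = (\<Sum>n<M. f (int n) + f (-1 - int n))" for f :: "int \<Rightarrow> 'a::comm_monoid_add"
proof (induction M)
  case (Suc M)
  have "{-int (Suc M)..<int (Suc M)} = insert (int M) (insert (-1 - int M) {-int M..<int M})"
    by auto
  then show ?case
    using Suc by (simp add: ac_simps)
qed simp

section \<open>Cotangent expansions from the reflection formula\<close>

text \<open>Differentiate Euler's reflection formula: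
  \<open>Gamma t * Gamma (1 - t) * sin (pi * t)\<close> is constantly pi off the integers, so its
  derivative vanishes there.\<close>

lemma Digamma_reflection_real:
  fixes x :: real
  assumes "x \<notin> \<int>"
  shows "Digamma (1 - x) - Digamma x = pi * cot (pi * x)"
proof -
  have nz: "sin (pi * t) \<noteq> 0" if "t \<notin> \<int>" for t :: real
    using that sin_zero_iff_int2[of "pi * t"] by (auto simp: Ints_def)
  have nonint: "1 - x \<notin> \<int>"
    using assms Ints_diff[of 1 "1 - x"] by auto
  then have x: "x \<notin> \<int>\<^sub>\<le>\<^sub>0" "1 - x \<notin> \<int>\<^sub>\<le>\<^sub>0"
    using assms nonpos_Ints_subset_Ints by blast+
  define h where "h = (\<lambda>t. Gamma t * Gamma (1 - t) * sin (pi * t))"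
  have const: "h t = pi" if "t \<notin> \<int>" for t
  proof -
    have "complex_of_real (Gamma t * Gamma (1 - t)) = of_real (pi / sin (pi * t))"
      using Gamma_reflection_complex[of "of_real t"]
      by (simp flip: Gamma_complex_of_real sin_of_real)
    then show ?thesis
      using nz[OF that] by (simp add: h_def del: of_real_mult of_real_divide)
  qed
  have "(h has_real_derivative
      (Gamma x * Digamma x * Gamma (1 - x) - Gamma x * (Gamma (1 - x) * Digamma (1 - x))) * sin (pi * x)
       + Gamma x * Gamma (1 - x) * (cos (pi * x) * pi)) (at x)"
    unfolding h_def using x by (auto intro!: derivative_eq_intros)
  moreover have "(h has_real_derivative 0) (at x)"
    by (rule has_field_derivative_transform_within_open[where S = "- \<int>" and f = "\<lambda>_. pi"])
       (use assms const in \<open>auto intro: open_Compl\<close>)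
  ultimately have "Gamma x * Gamma (1 - x) * ((Digamma x - Digamma (1 - x)) * sin (pi * x) + pi * cos (pi * x)) = 0"
    by (auto dest: DERIV_unique simp: algebra_simps)
  moreover have "Gamma x * Gamma (1 - x) \<noteq> 0"
    using x by (simp add: Gamma_eq_zero_iff)
  ultimately have "(Digamma x - Digamma (1 - x)) * sin (pi * x) + pi * cos (pi * x) = 0"
    by simp
  then show ?thesis
    using nz[OF assms] by (simp add: cot_def field_simps)
qed

text \<open>The Boolean index of \<open>cot_alg\<close> and \<open>trig_span\<close> records the parity of the function, \<open>True\<close> for even.\<close>

inductive cot_alg :: "bool \<Rightarrow> (real \<Rightarrow> real) \<Rightarrow> bool" where
  const: "r \<in> \<rat> \<Longrightarrow> cot_alg True (\<lambda>_. r)"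
| cot: "cot_alg False (\<lambda>x. cot (pi * x))"
| add: "cot_alg e f \<Longrightarrow> cot_alg e g \<Longrightarrow> cot_alg e (\<lambda>x. f x + g x)"
| mult: "cot_alg e f \<Longrightarrow> cot_alg e' g \<Longrightarrow> cot_alg (e = e') (\<lambda>x. f x * g x)"

lemma cot_alg_scale: "cot_alg e f \<Longrightarrow> r \<in> \<rat> \<Longrightarrow> cot_alg e (\<lambda>x. r * f x)"
  using cot_alg.mult[OF cot_alg.const] by auto

text \<open>Since cot' = -(1 + cot^2), differentiation yields pi times a rational polynomial in the
  cotangent of opposite parity. Keeping the factor pi outside preserves rationality of the
  coefficients.\<close>

lemma cot_alg_deriv:
  "cot_alg e f \<Longrightarrow> \<exists>g. cot_alg (\<not> e) g \<and> (\<forall>x. x \<notin> \<int> \<longrightarrow> (f has_real_derivative pi * g x) (at x))"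
proof (induction rule: cot_alg.induct)
  case (const r)
  \<comment> \<open>Constants enter only as even functions, so the odd zero function is written as a
    multiple of the cotangent.\<close>
  have "cot_alg False (\<lambda>x. 0 * cot (pi * x))"
    by (intro cot_alg_scale cot_alg.cot) auto
  then show ?case
    by (intro exI[of _ "\<lambda>_. 0"]) (auto intro!: derivative_eq_intros)
next
  case cot
  have "cot_alg (False = False) (\<lambda>x. cot (pi * x) * cot (pi * x))"
    by (intro cot_alg.intros)
  then have "cot_alg True (\<lambda>x. - 1 + (-1) * (cot (pi * x) * cot (pi * x)))"
    by (intro cot_alg.add cot_alg_scale cot_alg.const) auto
  moreover have "((\<lambda>x. cot (pi * x)) has_real_derivative
      pi * (- 1 + (-1) * (cot (pi * x) * cot (pi * x)))) (at x)" if "x \<notin> \<int>" for x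
  proof -
    have nz: "sin (pi * x) \<noteq> 0"
      using that sin_zero_iff_int2[of "pi * x"] by (auto simp: Ints_def)
    have "((\<lambda>x. cot (pi * x)) has_real_derivative - inverse ((sin (pi * x))\<^sup>2) * pi) (at x)"
      by (rule DERIV_chain2[where f = cot and g = "\<lambda>x. pi * x", OF DERIV_cot[OF nz]]) (auto intro!: derivative_eq_intros)
    moreover have "1 = (sin (pi * x))\<^sup>2 + (cos (pi * x))\<^sup>2" by simp
    then have "inverse ((sin (pi * x))\<^sup>2) = 1 + cot (pi * x) * cot (pi * x)"
      using nz by (simp add: cot_def field_simps power2_eq_square)
    ultimately show ?thesis by (simp add: algebra_simps)
  qed
  ultimately show ?case by auto
next
  case (add e f1 f2)
  then obtain g1 g2 where "cot_alg (\<not> e) g1" "cot_alg (\<not> e) g2"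
    "\<And>x. x \<notin> \<int> \<Longrightarrow> (f1 has_real_derivative pi * g1 x) (at x)"
    "\<And>x. x \<notin> \<int> \<Longrightarrow> (f2 has_real_derivative pi * g2 x) (at x)"
    by blast
  then show ?case
    by (intro exI[of _ "\<lambda>x. g1 x + g2 x"])
       (auto intro!: derivative_eq_intros cot_alg.add simp: algebra_simps)
next
  case (mult e1 f1 e2 f2)
  then obtain g1 g2 where g: "cot_alg (\<not> e1) g1" "cot_alg (\<not> e2) g2"
    "\<And>x. x \<notin> \<int> \<Longrightarrow> (f1 has_real_derivative pi * g1 x) (at x)"
    "\<And>x. x \<notin> \<int> \<Longrightarrow> (f2 has_real_derivative pi * g2 x) (at x)"
    by blast
  have "cot_alg ((\<not> e1) = e2) (\<lambda>x. g1 x * f2 x)" "cot_alg (e1 = (\<not> e2)) (\<lambda>x. f1 x * g2 x)"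
    using mult g by (auto intro: cot_alg.mult)
  moreover have "((\<not> e1) = e2) = (\<not> (e1 = e2))" "(e1 = (\<not> e2)) = (\<not> (e1 = e2))"
    by auto
  ultimately have "cot_alg (\<not> (e1 = e2)) (\<lambda>x. g1 x * f2 x + f1 x * g2 x)"
    by (simp only: cot_alg.add)
  with g show ?case
    by (intro exI[of _ "\<lambda>x. g1 x * f2 x + f1 x * g2 x"])
       (auto intro!: derivative_eq_intros simp: algebra_simps)
qed

text \<open>Differentiate the Digamma reflection formula \<open>n\<close> times: the inner
  derivative of \<open>1 - x\<close> supplies the alternating sign, and each step contributes one
  factor pi.\<close>

lemma Polygamma_reflection_real:
  "\<exists>f. cot_alg (odd n) f \<and>
    (\<forall>x. x \<notin> \<int> \<longrightarrow> (-1) ^ n * Polygamma n (1 - x) - Polygamma n x = pi ^ Suc n * f x)"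
proof (induction n)
  case 0
  show ?case
    by (intro exI[of _ "\<lambda>x. cot (pi * x)"]) (auto intro: cot_alg.cot simp: Digamma_reflection_real)
next
  case (Suc n)
  then obtain f where f: "cot_alg (odd n) f"
    "\<And>x. x \<notin> \<int> \<Longrightarrow> (-1) ^ n * Polygamma n (1 - x) - Polygamma n x = pi ^ Suc n * f x"
    by blast
  obtain g where g: "cot_alg (\<not> odd n) g" "\<And>x. x \<notin> \<int> \<Longrightarrow> (f has_real_derivative pi * g x) (at x)"
    using cot_alg_deriv[OF f(1)] by blast
  have "(-1) ^ Suc n * Polygamma (Suc n) (1 - x) - Polygamma (Suc n) x = pi ^ Suc (Suc n) * g x"
    if "x \<notin> \<int>" for x
  proof (rule DERIV_unique)
    have "1 - x \<notin> \<int>"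
      using that Ints_diff[of 1 "1 - x"] by auto
    then have x: "x \<notin> \<int>\<^sub>\<le>\<^sub>0" "1 - x \<notin> \<int>\<^sub>\<le>\<^sub>0"
      using that nonpos_Ints_subset_Ints by blast+
    then show "((\<lambda>x. (-1) ^ n * Polygamma n (1 - x) - Polygamma n x) has_real_derivative
        (-1) ^ Suc n * Polygamma (Suc n) (1 - x) - Polygamma (Suc n) x) (at x)"
      by (auto intro!: derivative_eq_intros)
    have "((\<lambda>x. pi ^ Suc n * f x) has_real_derivative pi ^ Suc (Suc n) * g x) (at x)"
      using g(2)[OF that] by (auto intro!: derivative_eq_intros)
    \<comment> \<open>The induction hypothesis holds only off the integers, but their complement is
      open, so it may be differentiated at \<open>x\<close>.\<close>
    then show "((\<lambda>x. (-1) ^ n * Polygamma n (1 - x) - Polygamma n x) has_real_derivative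
        pi ^ Suc (Suc n) * g x) (at x)"
      by (rule has_field_derivative_transform_within_open[where S = "- \<int>"])
         (use that f(2) in \<open>auto intro: open_Compl\<close>)
  qed
  with g(1) show ?case
    by (intro exI[of _ g]) auto
qed

text \<open>The Mittag-Leffler expansions of the cotangent and its derivatives. The terms with
  \<open>n \<ge> 0\<close> and with \<open>n < 0\<close> are, up to sign and a factorial, the
  Polygamma series at \<open>x\<close> and \<open>1 - x\<close>, which the reflection formula
  combines.\<close>

lemma cot_expansion:
  assumes "j > 0"
  shows "\<exists>f. cot_alg (even j) f \<and> (\<forall>x. x \<notin> \<int> \<longrightarrow>
    (\<lambda>M. \<Sum>n\<in>{-int M..<int M}. 1 / (x + of_int n) ^ j) \<longlonglongrightarrow> pi ^ j * f x)"
proof -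
  obtain n where j: "j = Suc n"
    using assms gr0_implies_Suc by blast
  obtain f where f: "cot_alg (odd n) f"
    "\<And>x. x \<notin> \<int> \<Longrightarrow> (-1) ^ n * Polygamma n (1 - x) - Polygamma n x = pi ^ j * f x"
    using Polygamma_reflection_real[of n] j by blast
  have split: "(\<Sum>n\<in>{-int M..<int M}. 1 / (x + of_int n) ^ j)
      = (\<Sum>i<M. inverse ((x + real i) ^ j)) + (-1) ^ j * (\<Sum>i<M. inverse ((1 - x + real i) ^ j))"
    for M and x :: real
  proof -
    have "1 / (x + of_int (- 1 - int i)) ^ j = (-1) ^ j * inverse ((1 - x + real i) ^ j)" for i
    proof -
      have "x + of_int (- 1 - int i) = -1 * (1 - x + real i)"
        by simp
      then show ?thesis
        by (simp only: power_mult_distrib divide_inverse inverse_mult_distrib) (simp flip: power_inverse)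
    qed
    then show ?thesis
      by (simp add: sum_symmetric_int sum.distrib sum_distrib_left inverse_eq_divide)
  qed
  have "(\<lambda>M. \<Sum>n\<in>{-int M..<int M}. 1 / (x + of_int n) ^ j)
      \<longlonglongrightarrow> (-1) ^ n / fact n * (pi ^ j * f x)" if "x \<notin> \<int>" for x
  proof -
    have x: "x \<noteq> 0" "1 - x \<noteq> 0" using that by auto
    show ?thesis
    \<comment> \<open>For \<open>j = 1\<close> each half diverges, and only the symmetric truncation
      lets the two logarithms in the Digamma limits cancel. For larger \<open>j\<close> the halves
      converge separately.\<close>
    proof (cases "n = 0")
      case True
      have "(\<lambda>M. (of_real (ln (real M)) - (\<Sum>i<M. inverse (1 - x + of_nat i)))
          - (of_real (ln (real M)) - (\<Sum>i<M. inverse (x + of_nat i)))) \<longlonglongrightarrow> Digamma (1 - x) - Digamma x"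
        by (intro tendsto_diff Digamma_LIMSEQ x)
      with True f(2)[OF that] show ?thesis
        unfolding split by (simp add: j algebra_simps)
    next
      case False
      have "(\<lambda>M. (\<Sum>i<M. inverse ((x + real i) ^ j)) + (-1) ^ j * (\<Sum>i<M. inverse ((1 - x + real i) ^ j)))
          \<longlonglongrightarrow> (-1) ^ Suc n * Polygamma n x / fact n + (-1) ^ j * ((-1) ^ Suc n * Polygamma n (1 - x) / fact n)"
        unfolding j
        by (intro tendsto_intros Polygamma_LIMSEQ[unfolded sums_def] x) (use False in auto)
      moreover have "(-1) ^ Suc n * Polygamma n x / fact n + (-1) ^ j * ((-1) ^ Suc n * Polygamma n (1 - x) / fact n)
          = (-1) ^ n / fact n * (pi ^ j * f x)"
      proof -
        \<comment> \<open>The reflection formula solved for \<open>Polygamma n (1 - x)\<close>, as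
          \<open>(-1) ^ n\<close> is its own inverse.\<close>
        have eq: "Polygamma n (1 - x) = (-1) ^ n * (Polygamma n x + pi ^ j * f x)"
          using f(2)[OF that] by (cases "even n") (simp_all add: algebra_simps)
        show ?thesis
          unfolding eq j by (cases "even n") (simp_all add: add_divide_distrib diff_divide_distrib)
      qed
      ultimately show ?thesis by (simp only: split)
    qed
  qed
  moreover have "cot_alg (even j) (\<lambda>x. (-1) ^ n / fact n * f x)"
  proof (rule cot_alg_scale)
    have "fact n \<in> (\<rat> :: real set)"
      by (metis Rats_of_nat of_nat_fact)
    then show "(-1) ^ n / fact n \<in> (\<rat> :: real set)" by simp
  qed (use f(1) j in simp)
  ultimately show ?thesis
    by (intro exI[of _ "\<lambda>x. (-1) ^ n / fact n * f x"]) (auto simp: mult_ac)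
qed

text \<open>At integers \<open>sin (pi * x)\<close> vanishes and division by zero gives the
  cotangent the value 0; at 1/2 it truly is 0. So at these points only the rational constant term
  survives, and an odd polynomial has none.\<close>

lemma cot_alg_values:
  "cot_alg e f \<Longrightarrow> f (real i) = f 0 \<and> f 0 \<in> \<rat> \<and> f (1/2) \<in> \<rat> \<and> (\<not> e \<longrightarrow> f 0 = 0)"
proof (induction rule: cot_alg.induct)
  case cot
  then show ?case
    by (simp add: cot_def mult.commute)
qed auto

section \<open>Finite Fourier expansions modulo \<open>b\<close>\<close>

inductive trig_span :: "nat \<Rightarrow> bool \<Rightarrow> (nat \<Rightarrow> real) \<Rightarrow> bool" for b where
  cos: "r \<in> \<rat> \<Longrightarrow> trig_span b True (\<lambda>c. r * cos (2 * pi * of_int d * real c / real b))"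
| sin: "r \<in> \<rat> \<Longrightarrow> trig_span b False (\<lambda>c. r * sin (2 * pi * of_int d * real c / real b))"
| add: "trig_span b e f \<Longrightarrow> trig_span b e g \<Longrightarrow> trig_span b e (\<lambda>c. f c + g c)"

lemma trig_span_const: "r \<in> \<rat> \<Longrightarrow> trig_span b True (\<lambda>_. r)"
  using trig_span.cos[of r b 0] by simp

lemma trig_span_zero: "trig_span b e (\<lambda>_. 0)"
  using trig_span.cos[of 0 b 0] trig_span.sin[of 0 b 0] by (cases e) auto

lemma trig_span_sum:
  "finite A \<Longrightarrow> (\<And>d. d \<in> A \<Longrightarrow> trig_span b e (f d)) \<Longrightarrow> trig_span b e (\<lambda>c. \<Sum>d\<in>A. f d c)"
  by (induction A rule: finite_induct) (auto intro: trig_span.add trig_span_zero)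

text \<open>The product-to-sum formulas: like factors give cosines and mixed ones give sines, with
  coefficients merely halved, hence still rational.\<close>

lemma trig_span_mult:
  assumes "trig_span b e f" "trig_span b e' g"
  shows "trig_span b (e = e') (\<lambda>c. f c * g c)"
  using assms
proof (induction rule: trig_span.induct)
  case (cos r d)
  define \<alpha> where "\<alpha> = (\<lambda>d c. 2 * pi * of_int d * real c / real b)"
  from cos(2) show ?case
  proof (induction rule: trig_span.induct)
    case (cos s d')
    have "trig_span b True (\<lambda>c. (r * s / 2) * cos (\<alpha> (d - d') c) + (r * s / 2) * cos (\<alpha> (d + d') c))"
      unfolding \<alpha>_def using \<open>r \<in> \<rat>\<close> cos by (intro trig_span.intros) auto
    also have "(\<lambda>c. (r * s / 2) * cos (\<alpha> (d - d') c) + (r * s / 2) * cos (\<alpha> (d + d') c))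
        = (\<lambda>c. r * cos (\<alpha> d c) * (s * cos (\<alpha> d' c)))"
      by (auto simp: \<alpha>_def ring_distribs add_divide_distrib diff_divide_distrib cos_add cos_diff)
    finally show ?case by (simp add: \<alpha>_def)
  next
    case (sin s d')
    have "trig_span b False (\<lambda>c. (r * s / 2) * sin (\<alpha> (d + d') c) + (- r * s / 2) * sin (\<alpha> (d - d') c))"
      unfolding \<alpha>_def using \<open>r \<in> \<rat>\<close> sin by (intro trig_span.intros) auto
    also have "(\<lambda>c. (r * s / 2) * sin (\<alpha> (d + d') c) + (- r * s / 2) * sin (\<alpha> (d - d') c))
        = (\<lambda>c. r * cos (\<alpha> d c) * (s * sin (\<alpha> d' c)))"
      by (auto simp: \<alpha>_def ring_distribs add_divide_distrib diff_divide_distrib sin_add sin_diff)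
    finally show ?case by (simp add: \<alpha>_def)
  qed (auto simp: ring_distribs intro: trig_span.add)
next
  case (sin r d)
  define \<alpha> where "\<alpha> = (\<lambda>d c. 2 * pi * of_int d * real c / real b)"
  from sin(2) show ?case
  proof (induction rule: trig_span.induct)
    case (cos s d')
    have "trig_span b False (\<lambda>c. (r * s / 2) * sin (\<alpha> (d + d') c) + (r * s / 2) * sin (\<alpha> (d - d') c))"
      unfolding \<alpha>_def using \<open>r \<in> \<rat>\<close> cos by (intro trig_span.intros) auto
    also have "(\<lambda>c. (r * s / 2) * sin (\<alpha> (d + d') c) + (r * s / 2) * sin (\<alpha> (d - d') c))
        = (\<lambda>c. r * sin (\<alpha> d c) * (s * cos (\<alpha> d' c)))"
      by (auto simp: \<alpha>_def ring_distribs add_divide_distrib diff_divide_distrib sin_add sin_diff)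
    finally show ?case by (simp add: \<alpha>_def)
  next
    case (sin s d')
    have "trig_span b True (\<lambda>c. (r * s / 2) * cos (\<alpha> (d - d') c) + (- r * s / 2) * cos (\<alpha> (d + d') c))"
      unfolding \<alpha>_def using \<open>r \<in> \<rat>\<close> sin by (intro trig_span.intros) auto
    also have "(\<lambda>c. (r * s / 2) * cos (\<alpha> (d - d') c) + (- r * s / 2) * cos (\<alpha> (d + d') c))
        = (\<lambda>c. r * sin (\<alpha> d c) * (s * sin (\<alpha> d' c)))"
      by (auto simp: \<alpha>_def ring_distribs add_divide_distrib diff_divide_distrib cos_add cos_diff)
    finally show ?case by (simp add: \<alpha>_def)
  qed (auto simp: ring_distribs intro: trig_span.add)
qed (auto simp: ring_distribs intro: trig_span.add)

lemma trig_span_scale: "r \<in> \<rat> \<Longrightarrow> trig_span b e f \<Longrightarrow> trig_span b e (\<lambda>c. r * f c)"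
  using trig_span_mult[OF trig_span_const, of r b e f] by simp

lemma sin_pi_div_eq_0_iff:
  assumes "b > 0"
  shows "sin (pi * real c / real b) = 0 \<longleftrightarrow> b dvd c"
proof
  assume "sin (pi * real c / real b) = 0"
  then obtain i :: int where "pi * real c / real b = of_int i * pi"
    by (auto simp: sin_zero_iff_int2)
  then have "real c = of_int i * real b"
    using assms by (simp add: field_simps)
  then have "int c = i * int b"
    by (metis of_int_eq_iff of_int_mult of_int_of_nat_eq)
  then show "b dvd c"
    by (metis dvd_triv_right int_dvd_int_iff)
qed (use assms in \<open>auto elim!: dvdE simp: mult.commute\<close>)

text \<open>Orthogonality of characters: the mean over \<open>d\<close> of exp(2 pi i d c / b) is
  the indicator of \<open>b dvd c\<close>, and the real part of this mean is the required
  combination of cosines.\<close>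

lemma dvd_indicator_trig_span:
  assumes "b > 0"
  shows "trig_span b True (\<lambda>c. if b dvd c then 1 else 0)"
proof -
  have "trig_span b True (\<lambda>c. \<Sum>d<b. (1 / real b) * cos (2 * pi * of_int (int d) * real c / real b))"
    by (intro trig_span_sum trig_span.cos) auto
  also have "(\<lambda>c. \<Sum>d<b. (1 / real b) * cos (2 * pi * of_int (int d) * real c / real b))
      = (\<lambda>c. if b dvd c then 1 else 0)"
  proof
    fix c
    define \<theta> where "\<theta> = pi * real c / real b"
    have \<theta>: "2 * pi * of_int (int d) * real c / real b = 2 * real d * \<theta>" for d
      by (simp add: \<theta>_def)
    have b\<theta>: "real b * \<theta> = real c * pi"
      using assms by (simp add: \<theta>_def)
    \<comment> \<open>Each summand is a difference: 2 sin \<theta> cos (2d \<theta>) = sin ((2d + 1)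
      \<theta>) - sin ((2d - 1) \<theta>).\<close>
    have telescope: "2 * sin \<theta> * (\<Sum>d<K. cos (2 * real d * \<theta>)) = sin (2 * real K * \<theta> - \<theta>) + sin \<theta>" for K
    proof (induction K)
      case (Suc K)
      have "sin (2 * real (Suc K) * \<theta> - \<theta>) = sin (2 * real K * \<theta> + \<theta>)"
        by (simp add: algebra_simps)
      with Suc show ?case
        by (simp add: ring_distribs sin_add sin_diff)
    qed simp
    have "(\<Sum>d<b. cos (2 * real d * \<theta>)) = (if b dvd c then real b else 0)"
    proof (cases "b dvd c")
      case True
      then obtain i where "c = b * i" by blast
      then have "\<theta> = real i * pi" using assms by (simp add: \<theta>_def)
      then have "cos (2 * real d * \<theta>) = 1" for d
        using cos_2npi[of "d * i"] by (simp add: mult_ac)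
      then show ?thesis using True by simp
    next
      case False
      have "2 * real b * \<theta> = real (2 * c) * pi"
        using b\<theta> by simp
      then have "sin (2 * real b * \<theta> - \<theta>) = - sin \<theta>"
        by (simp only: sin_diff sin_npi cos_npi) simp
      then have "sin \<theta> * (\<Sum>d<b. cos (2 * real d * \<theta>)) = 0"
        using telescope[of b] by simp
      moreover have "sin \<theta> \<noteq> 0"
        using False sin_pi_div_eq_0_iff[OF assms] by (simp add: \<theta>_def)
      ultimately show ?thesis using False by simp
    qed
    then show "(\<Sum>d<b. (1 / real b) * cos (2 * pi * of_int (int d) * real c / real b))
        = (if b dvd c then 1 else 0)"
      using assms by (simp only: \<theta>) (simp flip: sum_divide_distrib)
  qed
  finally show ?thesis .
qed

text \<open>The finite Fourier expansion of the cotangent, with the sawtooth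
  \<open>- 2 * d / b\<close> as coefficients. It makes cotangent values linear in sines, which can
  then be summed against powers of \<open>m\<close>.\<close>

lemma cot_trig_span:
  assumes "b > 0"
  shows "trig_span b False (\<lambda>c. cot (pi * (real c / real b)))"
proof -
  have "trig_span b False (\<lambda>c. \<Sum>d<b. (- 2 * real d / real b) * sin (2 * pi * of_int (int d) * real c / real b))"
    by (intro trig_span_sum trig_span.sin) auto
  also have "(\<lambda>c. \<Sum>d<b. (- 2 * real d / real b) * sin (2 * pi * of_int (int d) * real c / real b))
      = (\<lambda>c. cot (pi * (real c / real b)))"
  proof
    fix c
    define \<theta> where "\<theta> = pi * real c / real b"
    have \<theta>: "2 * pi * of_int (int d) * real c / real b = 2 * real d * \<theta>" for d
      by (simp add: \<theta>_def)
    have b\<theta>: "real b * \<theta> = real c * pi"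
      using assms by (simp add: \<theta>_def)
    define S where "S = (\<Sum>d<b. real d * sin (2 * real d * \<theta>))"
    \<comment> \<open>At \<open>K = b\<close> this yields the finite Fourier expansion of \<open>cot\<close>, also for \<open>b dvd c\<close>, where \<open>cot\<close> has the junk value 0.\<close>
    have telescope: "4 * (sin \<theta>)\<^sup>2 * (\<Sum>d<K. real d * sin (2 * real d * \<theta>))
        = real K * sin (2 * real K * \<theta> - 2 * \<theta>) - (real K - 1) * sin (2 * real K * \<theta>)" for K
    proof (induction K)
      case (Suc K)
      have "2 * real (Suc K) * \<theta> = 2 * real K * \<theta> + 2 * \<theta>"
        by (simp add: algebra_simps)
      moreover have "4 * (sin \<theta>)\<^sup>2 = 2 - 2 * cos (2 * \<theta>)"
        by (simp add: cos_double_sin)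
      ultimately show ?case
        using Suc by (simp add: ring_distribs sin_add sin_diff)
    qed simp
    have "S = - (real b / 2) * cot \<theta>"
    proof (cases "b dvd c")
      case True
      then obtain i where "c = b * i" by blast
      then have i: "\<theta> = real i * pi" using assms by (simp add: \<theta>_def)
      then have "sin (2 * real d * \<theta>) = 0" for d
        using sin_npi[of "2 * d * i"] by (simp add: mult_ac)
      then show ?thesis by (simp add: S_def i)
    next
      case False
      have "2 * real b * \<theta> = real (2 * c) * pi"
        using b\<theta> by simp
      then have "4 * (sin \<theta>)\<^sup>2 * S = - real b * sin (2 * \<theta>)"
        unfolding S_def telescope by (simp only: sin_diff sin_npi cos_npi) simp
      then have "sin \<theta> * (2 * sin \<theta> * S) = sin \<theta> * (- real b * cos \<theta>)"
        unfolding sin_double by (simp add: power2_eq_square algebra_simps)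
      moreover have nz: "sin \<theta> \<noteq> 0"
        using False sin_pi_div_eq_0_iff[OF assms] by (simp add: \<theta>_def)
      ultimately have "2 * sin \<theta> * S = - real b * cos \<theta>"
        using mult_left_cancel[OF nz] by blast
      with nz show ?thesis
        by (simp add: cot_def field_simps)
    qed
    then have "(- 2 / real b) * S = cot \<theta>"
      using assms by simp
    moreover have "(\<Sum>d<b. (- 2 * real d / real b) * sin (2 * real d * \<theta>)) = (- 2 / real b) * S"
      unfolding S_def sum_distrib_left by (intro sum.cong) auto
    ultimately show "(\<Sum>d<b. (- 2 * real d / real b) * sin (2 * pi * of_int (int d) * real c / real b))
        = cot (pi * (real c / real b))"
      by (simp only: \<theta>) (simp add: \<theta>_def)
  qed
  finally show ?thesis .
qed

text \<open>Both classes are closed under sums and products with the same parity rule, so the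
  generators suffice. Multiples of \<open>b\<close> are included because
  \<open>cot_trig_span\<close> covers them.\<close>

lemma cot_alg_trig_span:
  "cot_alg e f \<Longrightarrow> b > 0 \<Longrightarrow> trig_span b e (\<lambda>c. f (real c / real b))"
proof (induction rule: cot_alg.induct)
  case cot
  then show ?case by (rule cot_trig_span)
qed (auto intro: trig_span_const trig_span.add trig_span_mult)

section \<open>Symmetric sums at integer points and along progressions\<close>

lemma inverse_shift_tendsto_0: "(\<lambda>M. inverse (x + real M)) \<longlonglongrightarrow> 0"
  by (intro tendsto_inverse_0_at_top filterlim_tendsto_add_at_top[OF tendsto_const filterlim_real_sequentially])

text \<open>Moving the window by one changes the partial sum only by two boundary terms, and these
  tend to 0 because \<open>j > 0\<close>.\<close>

lemma symmetric_sum_shift: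
  assumes "j > 0" "(\<lambda>M. \<Sum>n\<in>{-int M..<int M}. 1 / (x + of_int n) ^ j) \<longlonglongrightarrow> (l::real)"
  shows "(\<lambda>M. \<Sum>n\<in>{-int M..<int M}. 1 / (x + 1 + of_int n) ^ j) \<longlonglongrightarrow> l"
proof -
  have telescope: "(\<Sum>n\<in>{-int M..<int M}. F (n + 1)) = (\<Sum>n\<in>{-int M..<int M}. F n) + F (int M) - F (- int M)"
    for M and F :: "int \<Rightarrow> real"
    unfolding sum_symmetric_int by (induction M) (simp_all add: algebra_simps)
  have "(\<lambda>M. inverse (x + real M) ^ j - (- inverse (- x + real M)) ^ j) \<longlonglongrightarrow> 0 ^ j - (- 0) ^ j"
    by (intro tendsto_intros inverse_shift_tendsto_0)
  moreover have "- inverse (- x + real M) = inverse (x - real M)" for M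
    by (simp flip: inverse_minus_eq)
  ultimately have "(\<lambda>M. 1 / (x + real M) ^ j - 1 / (x - real M) ^ j) \<longlonglongrightarrow> 0"
    by (simp only: power_inverse inverse_eq_divide) (simp add: power_one_over)
  from tendsto_add[OF assms(2) this, unfolded add_0_right] show ?thesis
  proof (rule Lim_transform_eventually, intro always_eventually allI)
    fix M
    have shift: "x + 1 + of_int n = x + of_int (n + 1)" for n by simp
    show "(\<Sum>n\<in>{-int M..<int M}. 1 / (x + of_int n) ^ j) + (1 / (x + real M) ^ j - 1 / (x - real M) ^ j)
        = (\<Sum>n\<in>{-int M..<int M}. 1 / (x + 1 + of_int n) ^ j)"
      unfolding shift using telescope[of "\<lambda>n. 1 / (x + of_int n) ^ j" M] by simp
  qed
qed

text \<open>Euler's evaluation of 2 \<zeta>(j) for even \<open>j\<close>, with the term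
  \<open>n = 0\<close> dropped by the convention \<open>1 / 0 = 0\<close>. For odd \<open>j\<close>
  the terms cancel in pairs.\<close>

lemma symmetric_sum_0:
  assumes "j > 0"
  shows "\<exists>r\<in>\<rat>. (odd j \<longrightarrow> r = 0) \<and> (\<lambda>M. \<Sum>n\<in>{-int M..<int M}. 1 / (of_int n) ^ j) \<longlonglongrightarrow> pi ^ j * r"
proof (cases "even j")
  case False
  \<comment> \<open>In the half-open range only the endpoint \<open>- M\<close> has no
    partner.\<close>
  have "(\<Sum>n\<in>{-int M..<int M}. 1 / (of_int n) ^ j) = - (inverse (0 + real M) ^ j)" for M
    unfolding sum_symmetric_int
  proof (induction M)
    case 0
    then show ?case using assms by simp
  next
    case (Suc M)
    have "- 1 - real M = - (1 + real M)" by simp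
    then have "(- 1 - real M) ^ j = - ((1 + real M) ^ j)"
      using power_minus_odd[OF False, of "1 + real M"] by (simp only:)
    then show ?case
      using Suc by (simp add: power_inverse inverse_eq_divide power_one_over)
  qed
  moreover have "(\<lambda>M. - (inverse (0 + real M) ^ j)) \<longlonglongrightarrow> 0"
    using tendsto_minus[OF tendsto_power[OF inverse_shift_tendsto_0[of 0], of j]] assms
    by (simp add: zero_power)
  ultimately show ?thesis using assms False by (intro bexI[of _ 0]) auto
next
  case True
  define A where "A = (\<lambda>M. \<Sum>n\<in>{-int M..<int M}. 1 / (of_int n :: real) ^ j)"
  have "j \<ge> 2" using True assms by presburger
  have "A = (\<lambda>M. (\<Sum>n<M. inverse (real n ^ j)) + (\<Sum>n<M. inverse (real (Suc n) ^ j)))"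
  proof
    fix M
    have "(- 1 - real n) ^ j = real (Suc n) ^ j" for n
      using power_minus_even[OF True, of "real (Suc n)"] by simp
    then show "A M = (\<Sum>n<M. inverse (real n ^ j)) + (\<Sum>n<M. inverse (real (Suc n) ^ j))"
      using True unfolding A_def sum_symmetric_int
      by (simp add: sum.distrib inverse_eq_divide del: of_nat_Suc)
  qed
  moreover have s: "summable (\<lambda>n. inverse (real n ^ j))"
    using inverse_power_summable[OF \<open>j \<ge> 2\<close>, where 'a = real] .
  moreover from s have "summable (\<lambda>n. inverse (real (Suc n) ^ j))"
    by (subst summable_Suc_iff)
  \<comment> \<open>The limit must exist first; the duplication relation below then determines its
    value.\<close>
  ultimately have "convergent A"
    by (auto simp: summable_iff_convergent intro: convergent_add)
  then obtain l where l: "A \<longlonglongrightarrow> l" by (auto simp: convergent_def)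
  obtain f where f: "cot_alg (even j) f"
    "\<And>x. x \<notin> \<int> \<Longrightarrow> (\<lambda>M. \<Sum>n\<in>{-int M..<int M}. 1 / (x + of_int n) ^ j) \<longlonglongrightarrow> pi ^ j * f x"
    using cot_expansion[OF assms] by blast
  have half: "(1/2 :: real) \<notin> \<int>"
    using fraction_not_in_Ints[where 'a = real, of 2 1] by simp
  \<comment> \<open>The half-open range makes this exact: \<open>-2M..<2M\<close> consists of the
    pairs \<open>2n\<close>, \<open>2n + 1\<close> with \<open>n\<close> in
    \<open>-M..<M\<close>.\<close>
  have dup: "(\<Sum>n\<in>{-int (2 * M)..<int (2 * M)}. F n) = (\<Sum>n\<in>{-int M..<int M}. F (2 * n) + F (2 * n + 1))"
    for M and F :: "int \<Rightarrow> real"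
    unfolding sum_symmetric_int by (induction M) (simp_all add: algebra_simps)
  \<comment> \<open>Splitting by parity expresses \<open>2 \<zeta>(j)\<close> by the cotangent polynomial at \<open>1/2\<close>, where \<open>cot\<close> vanishes.\<close>
  have "A (2 * M) * 2 ^ j = A M + (\<Sum>n\<in>{-int M..<int M}. 1 / (1/2 + of_int n) ^ j)" for M
  proof -
    have "1 / (of_int (2 * n)) ^ j = (1 / 2 ^ j) * (1 / (of_int n) ^ j :: real)" for n
      by (simp add: power_mult_distrib)
    moreover have "1 / (of_int (2 * n + 1)) ^ j = (1 / 2 ^ j) * (1 / (1/2 + of_int n) ^ j :: real)" for n
    proof -
      have "of_int (2 * n + 1) = 2 * (1/2 + of_int n :: real)" by simp
      then show ?thesis by (simp only: power_mult_distrib) simp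
    qed
    ultimately have "A (2 * M) = (\<Sum>n\<in>{-int M..<int M}. (1 / 2 ^ j) * (1 / (of_int n) ^ j)
        + (1 / 2 ^ j) * (1 / (1/2 + of_int n) ^ j))"
      unfolding A_def dup by (simp only:)
    then have "A (2 * M) = (1 / 2 ^ j) * A M + (1 / 2 ^ j) * (\<Sum>n\<in>{-int M..<int M}. 1 / (1/2 + of_int n) ^ j)"
      by (simp only: A_def sum.distrib sum_distrib_left)
    then show ?thesis
      by (simp add: distrib_right)
  qed
  moreover have "(\<lambda>M. A M + (\<Sum>n\<in>{-int M..<int M}. 1 / (1/2 + of_int n) ^ j)) \<longlonglongrightarrow> l + pi ^ j * f (1/2)"
    by (intro tendsto_add l f half)
  moreover have "(\<lambda>M. A (2 * M) * 2 ^ j) \<longlonglongrightarrow> l * 2 ^ j"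
    by (intro tendsto_intros filterlim_compose[OF l] filterlim_subseq) (auto simp: strict_mono_def)
  ultimately have "l * 2 ^ j = l + pi ^ j * f (1/2)"
    using LIMSEQ_unique by auto
  moreover have "(1::real) < 2 ^ j" using assms by (intro one_less_power) auto
  ultimately have "l = pi ^ j * (f (1/2) / (2 ^ j - 1))"
    by (simp add: field_simps)
  moreover have "f (1/2) / (2 ^ j - 1) \<in> \<rat>"
    using cot_alg_values[OF f(1)] by auto
  ultimately show ?thesis using l True unfolding A_def by blast
qed

text \<open>Factoring out \<open>b ^ j\<close> reduces to the expansion at \<open>x = c / b\<close>.
  This point is an integer exactly when \<open>b dvd c\<close>, and there the pole term is
  dropped.\<close>

lemma symmetric_sum_progression:
  assumes "b > 0" "j > 0"
  shows "\<exists>f. trig_span b (even j) f \<and> (\<forall>c.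
    (\<lambda>M. \<Sum>n\<in>{-int M..<int M}. 1 / (real c + real b * of_int n) ^ j) \<longlonglongrightarrow> pi ^ j * f c)"
proof -
  obtain f where f: "cot_alg (even j) f"
    "\<And>x. x \<notin> \<int> \<Longrightarrow> (\<lambda>M. \<Sum>n\<in>{-int M..<int M}. 1 / (x + of_int n) ^ j) \<longlonglongrightarrow> pi ^ j * f x"
    using cot_expansion[OF assms(2)] by blast
  note val = cot_alg_values[OF f(1)]
  obtain r where r: "r \<in> \<rat>" "odd j \<Longrightarrow> r = 0"
    "(\<lambda>M. \<Sum>n\<in>{-int M..<int M}. 1 / (of_int n) ^ j) \<longlonglongrightarrow> pi ^ j * r"
    using symmetric_sum_0[OF assms(2)] by blast
  \<comment> \<open>At multiples of \<open>b\<close> the polynomial \<open>f\<close> has the default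
    value \<open>f 0\<close> instead of the true limit factor \<open>r\<close>; the indicator
    corrects this. For odd \<open>j\<close> both are 0, so no even term intrudes.\<close>
  define g where "g = (\<lambda>c. f (real c / real b) + (r - f 0) * (if b dvd c then 1 else 0))"
  have "trig_span b (even j) g"
  proof (cases "even j")
    case True
    then show ?thesis
      unfolding g_def using cot_alg_trig_span[OF f(1) assms(1)] dvd_indicator_trig_span[OF assms(1)] val r
      by (intro trig_span.add trig_span_scale) auto
  next
    case False
    then show ?thesis
      unfolding g_def using cot_alg_trig_span[OF f(1) assms(1)] val[of 0] r by simp
  qed
  then have "trig_span b (even j) (\<lambda>c. (1 / real b ^ j) * g c)"
    by (intro trig_span_scale) auto
  moreover have "(\<lambda>M. \<Sum>n\<in>{-int M..<int M}. 1 / (real c + real b * of_int n) ^ j) \<longlonglongrightarrow> pi ^ j * ((1 / real b ^ j) * g c)"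
    for c
  proof -
    have "(\<lambda>M. \<Sum>n\<in>{-int M..<int M}. 1 / (real c / real b + of_int n) ^ j) \<longlonglongrightarrow> pi ^ j * g c"
    proof (cases "b dvd c")
      case True
      then obtain i where c: "c = b * i" by blast
      \<comment> \<open>Integer points are reached from \<open>x = 0\<close> by repeated unit
        shifts.\<close>
      have "(\<lambda>M. \<Sum>n\<in>{-int M..<int M}. 1 / (real i + of_int n) ^ j) \<longlonglongrightarrow> pi ^ j * r"
      proof (induction i)
        case (Suc i)
        from symmetric_sum_shift[OF assms(2) this] show ?case
          by (simp add: add_ac)
      qed (use r in simp)
      then show ?thesis using assms val[of i] by (simp add: g_def c)
    next
      case False
      have "real c / real b \<notin> \<int>"
      proof
        assume "real c / real b \<in> \<int>"
        then obtain i where "real c / real b = of_int i"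
          by (elim Ints_cases)
        then have "sin (pi * (real c / real b)) = 0"
          by (simp only:) simp
        then show False using False sin_pi_div_eq_0_iff[OF assms(1), of c] by simp
      qed
      then show ?thesis using f(2) False by (simp add: g_def)
    qed
    then have "(\<lambda>M. (1 / real b ^ j) * (\<Sum>n\<in>{-int M..<int M}. 1 / (real c / real b + of_int n) ^ j))
        \<longlonglongrightarrow> (1 / real b ^ j) * (pi ^ j * g c)"
      by (intro tendsto_intros)
    moreover have "(1 / real b ^ j) * (1 / (real c / real b + of_int n) ^ j) = 1 / (real c + real b * of_int n) ^ j" for n
    proof -
      have "real c + real b * of_int n = real b * (real c / real b + of_int n)"
        using assms by (simp add: field_simps)
      then show ?thesis by (simp only: power_mult_distrib) simp
    qed
    ultimately show ?thesis by (simp add: sum_distrib_left mult_ac)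
  qed
  ultimately show ?thesis by blast
qed

section \<open>Rational combinations of Clausen values\<close>

lemma polylog_periodic: "polylog k (exp (2 * of_real pi * \<i> * of_real (x + of_int i)))
    = polylog k (exp (2 * of_real pi * \<i> * of_real x))"
proof -
  have "2 * of_real pi * \<i> * of_real (x + of_int i)
      = 2 * of_real pi * \<i> * of_real x + of_real (of_int (2 * i) * pi) * \<i>"
    by (simp add: algebra_simps)
  then have "exp (2 * of_real pi * \<i> * of_real (x + of_int i)) = exp (2 * of_real pi * \<i> * of_real x)"
    unfolding exp_eq by blast
  then show ?thesis by simp
qed

lemma clausen_periodic:
  "clausen_C k (x + of_int i) = clausen_C k x" "clausen_S k (x + of_int i) = clausen_S k x"
  by (simp_all only: clausen_C_def clausen_S_def polylog_periodic)

text \<open>Here \<open>d\<close> is an arbitrary integer, so arguments stay unreduced while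
  combinations are built; \<open>clausen_span_explicit\<close> reduces them modulo \<open>N\<close>
  by periodicity.\<close>

inductive clausen_span :: "nat \<Rightarrow> nat \<Rightarrow> real \<Rightarrow> bool" for k N where
  C: "r \<in> \<rat> \<Longrightarrow> n \<le> (k - 3) div 2 \<Longrightarrow>
      clausen_span k N (r * (pi ^ (2 * n) * clausen_C (k - 2 * n) (of_int d / real N)))"
| S: "r \<in> \<rat> \<Longrightarrow> n \<le> (k - 3) div 2 \<Longrightarrow>
      clausen_span k N (r * (pi ^ (2 * n + 1) * clausen_S (k - 2 * n - 1) (of_int d / real N)))"
| add: "clausen_span k N x \<Longrightarrow> clausen_span k N y \<Longrightarrow> clausen_span k N (x + y)"

lemma clausen_span_scale: "clausen_span k N x \<Longrightarrow> s \<in> \<rat> \<Longrightarrow> clausen_span k N (s * x)"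
proof (induction rule: clausen_span.induct)
  case (C r n d)
  then show ?case
    using clausen_span.C[of "s * r" n k N d] by (simp add: mult.assoc)
next
  case (S r n d)
  then show ?case
    using clausen_span.S[of "s * r" n k N d] by (simp add: mult.assoc)
qed (simp add: distrib_left clausen_span.add)

lemma clausen_span_diff: "clausen_span k N x \<Longrightarrow> clausen_span k N y \<Longrightarrow> clausen_span k N (x - y)"
  using clausen_span.add[of k N x "- 1 * y"] clausen_span_scale[of k N y "- 1"] by simp

lemma of_int_divide_mod:
  assumes "N > 0"
  shows "\<exists>d' i. d' < N \<and> of_int d / real N = real d' / real N + of_int i"
proof -
  have "of_int d = (of_int (d mod int N + int N * (d div int N)) :: real)"
    by simp
  also have "\<dots> = real (nat (d mod int N)) + real N * of_int (d div int N)"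
    unfolding of_int_add of_int_mult using assms by simp
  finally have "of_int d / real N = real (nat (d mod int N)) / real N + of_int (d div int N)"
    using assms by (simp add: field_simps)
  moreover have "nat (d mod int N) < N"
    using assms by (simp add: nat_less_iff)
  ultimately show ?thesis by blast
qed

lemma sum_sum_delta:
  fixes X :: "nat \<Rightarrow> nat \<Rightarrow> real"
  assumes "n \<le> K" "d < N"
  shows "(\<Sum>i = 0..K. \<Sum>j = 0..<N. of_rat (if i = n \<and> j = d then r else 0) * X i j) = of_rat r * X n d"
proof -
  have "(\<Sum>j = 0..<N. of_rat (if i = n \<and> j = d then r else 0) * X i j)
      = (if i = n then of_rat r * X n d else 0)" for i
  proof (cases "i = n")
    case True
    have "(\<Sum>j = 0..<N. of_rat (if i = n \<and> j = d then r else 0) * X i j)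
        = (\<Sum>j = 0..<N. if j = d then of_rat r * X n d else 0)"
      by (intro sum.cong) (auto simp: True)
    then show ?thesis using assms True by simp
  qed simp
  then show ?thesis using assms by simp
qed

text \<open>A generator corresponds to a coefficient table with at most one nonzero entry, located
  by reducing \<open>d\<close> modulo \<open>N\<close>; sums add the tables.\<close>

lemma clausen_span_explicit:
  assumes "clausen_span k N x" "N > 0"
  shows "\<exists>p q :: nat \<Rightarrow> nat \<Rightarrow> rat. x = (\<Sum>n = 0..(k - 3) div 2. \<Sum>d = 0..<N.
          of_rat (p n d) * (pi ^ (2 * n) * clausen_C (k - 2 * n) (real d / real N))
        + of_rat (q n d) * (pi ^ (2 * n + 1) * clausen_S (k - 2 * n - 1) (real d / real N)))"
  using assms(1)
proof (induction rule: clausen_span.induct)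
  case (C r n d)
  obtain r' where r: "r = of_rat r'" using C(1) Rats_cases by blast
  obtain d' i where d: "d' < N" "of_int d / real N = real d' / real N + of_int i"
    using of_int_divide_mod[OF assms(2)] by blast
  show ?case
    unfolding d(2) clausen_periodic r
    using sum_sum_delta[OF C(2) d(1), of r' "\<lambda>n d. pi ^ (2 * n) * clausen_C (k - 2 * n) (real d / real N)"]
    by (intro exI[of _ "\<lambda>i j. if i = n \<and> j = d' then r' else 0"] exI[of _ "\<lambda>_ _. 0"]) simp
next
  case (S r n d)
  obtain r' where r: "r = of_rat r'" using S(1) Rats_cases by blast
  obtain d' i where d: "d' < N" "of_int d / real N = real d' / real N + of_int i"
    using of_int_divide_mod[OF assms(2)] by blast
  show ?case
    unfolding d(2) clausen_periodic r
    using sum_sum_delta[OF S(2) d(1), of r' "\<lambda>n d. pi ^ (2 * n + 1) * clausen_S (k - 2 * n - 1) (real d / real N)"]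
    by (intro exI[of _ "\<lambda>_ _. 0"] exI[of _ "\<lambda>i j. if i = n \<and> j = d' then r' else 0"]) simp
next
  case (add x y)
  obtain p1 q1 p2 q2 :: "nat \<Rightarrow> nat \<Rightarrow> rat" where
    x: "x = (\<Sum>n = 0..(k - 3) div 2. \<Sum>d = 0..<N.
          of_rat (p1 n d) * (pi ^ (2 * n) * clausen_C (k - 2 * n) (real d / real N))
        + of_rat (q1 n d) * (pi ^ (2 * n + 1) * clausen_S (k - 2 * n - 1) (real d / real N)))" and
    y: "y = (\<Sum>n = 0..(k - 3) div 2. \<Sum>d = 0..<N.
          of_rat (p2 n d) * (pi ^ (2 * n) * clausen_C (k - 2 * n) (real d / real N))
        + of_rat (q2 n d) * (pi ^ (2 * n + 1) * clausen_S (k - 2 * n - 1) (real d / real N)))"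
    using add.IH by blast
  show ?case
    unfolding x y sum.distrib[symmetric]
    by (rule exI[of _ "\<lambda>n d. p1 n d + p2 n d"], rule exI[of _ "\<lambda>n d. q1 n d + q2 n d"])
       (intro sum.cong refl, simp add: of_rat_add algebra_simps)
qed

text \<open>Summed against \<open>1 / m ^ i\<close>, a cosine or sine becomes a Clausen value of
  index \<open>i\<close>. The weight \<open>k\<close> splits as \<open>j\<close> for the power of pi
  plus \<open>i\<close>, and the parity of \<open>j\<close> selects the cosine or sine
  family.\<close>

lemma trig_span_sums_clausen:
  assumes "trig_span b e f" "b > 0" "b dvd N" "N > 0" "odd k" "j + i = k" "i \<ge> 2" "e = even j"
  shows "\<exists>x. (\<lambda>m. f (a * Suc m) / real (Suc m) ^ i) sums x \<and> clausen_span k N (pi ^ j * x)"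
proof -
  obtain c where N: "N = b * c" using assms(3) by blast
  then have c: "c > 0" using assms(4) by auto
  \<comment> \<open>Expanding the fraction by \<open>c = N / b\<close> puts the Clausen argument
    over the denominator \<open>N\<close>.\<close>
  have arg: "2 * pi * of_int d * real (a * Suc m) / real b
      = 2 * pi * real (Suc m) * (of_int (d * int a * int c) / real N)" for d m
    using assms(2) c by (simp add: N del: of_nat_Suc mult_Suc_right)
  show ?thesis
    using assms(1,8)
  proof (induction rule: trig_span.induct)
    case (cos r d)
    then obtain n where n: "j = 2 * n" by auto
    \<comment> \<open>As \<open>k\<close> is odd and \<open>j\<close> even, \<open>i\<close> is odd,
      so \<open>i \<ge> 2\<close> improves to \<open>i \<ge> 3\<close>; this is the bound on
      \<open>n\<close>.\<close>
    have k: "i = k - 2 * n" "n \<le> (k - 3) div 2"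
      using assms(5-7) n by presburger+
    show ?case
      using sums_mult[OF clausen_sums(1)[OF assms(7), of "of_int (d * int a * int c) / real N"], of r] clausen_span.C[OF cos(1) k(2), of N "d * int a * int c"]
      by (intro exI[of _ "r * clausen_C i (of_int (d * int a * int c) / real N)"])
         (simp only: arg n k(1)[symmetric] times_divide_eq_right mult.left_commute simp_thms)
  next
    case (sin r d)
    then obtain n where n: "j = 2 * n + 1" by (auto elim!: oddE)
    have k: "i = k - 2 * n - 1" "n \<le> (k - 3) div 2"
      using assms(5-7) n by presburger+
    show ?case
      using sums_mult[OF clausen_sums(2)[OF assms(7), of "of_int (d * int a * int c) / real N"], of r] clausen_span.S[OF sin(1) k(2), of N "d * int a * int c"]
      by (intro exI[of _ "r * clausen_S i (of_int (d * int a * int c) / real N)"])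
         (simp only: arg n k(1)[symmetric] times_divide_eq_right mult.left_commute simp_thms)
  next
    case (add e f g)
    then obtain x y where "(\<lambda>m. f (a * Suc m) / real (Suc m) ^ i) sums x" "clausen_span k N (pi ^ j * x)"
      "(\<lambda>m. g (a * Suc m) / real (Suc m) ^ i) sums y" "clausen_span k N (pi ^ j * y)"
      by blast
    then show ?case
      by (intro exI[of _ "x + y"]) (simp add: add_divide_distrib distrib_left sums_add clausen_span.add del: of_nat_Suc)
  qed
qed

section \<open>Partial fractions and inner sums\<close>

lemma symmetric_sum_remove:
  assumes "(\<lambda>M. \<Sum>n\<in>{-int M..<int M}. F n) \<longlonglongrightarrow> (l :: real)"
  shows "(\<lambda>M. \<Sum>n\<in>{-int M..<int M}. if n = c then 0 else F n) \<longlonglongrightarrow> l - F c"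
proof (rule Lim_transform_eventually)
  show "(\<lambda>M. (\<Sum>n\<in>{-int M..<int M}. F n) - F c) \<longlonglongrightarrow> l - F c"
    by (intro tendsto_intros assms)
  show "\<forall>\<^sub>F M in sequentially. (\<Sum>n\<in>{-int M..<int M}. F n) - F c = (\<Sum>n\<in>{-int M..<int M}. if n = c then 0 else F n)"
    using eventually_gt_at_top[of "nat \<bar>c\<bar>"]
  proof eventually_elim
    case (elim M)
    then have c: "c \<in> {-int M..<int M}" by auto
    have "(\<Sum>n\<in>{-int M..<int M}. if n = c then 0 else F n) = (\<Sum>n\<in>{-int M..<int M} - {c}. F n)"
      using c by (subst sum.remove[of _ c]) (auto intro!: sum.cong)
    then show ?case
      using c by (simp add: sum_diff1)
  qed
qed

text \<open>With s = am + bn, the identity am = s - bn gives 1/(n^p s^q) = (1/(am)) (1/(n^p s^(q-1))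
  - b/(n^(p-1) s^q)). Each use lowers \<open>p + q\<close> and moves one factor 1/m outside, so the
  weight stays \<open>k\<close> and \<open>r\<close> has grown to at least 2 when a pure power of
  \<open>n\<close> or of s remains.\<close>

lemma partial_fraction_clausen:
  assumes "a > 0" "b > 0" "b dvd N" "N > 0" "odd k"
  shows "p + q > 0 \<Longrightarrow> r + p + q = k \<Longrightarrow> r > 0 \<Longrightarrow> (p = 0 \<or> q = 0 \<Longrightarrow> r \<ge> 2) \<Longrightarrow>
    \<exists>f x. (\<forall>m>0. (\<lambda>M. \<Sum>n\<in>{-int M..<int M}.
        if n = 0 \<or> int (a * m) + int b * n = 0 then 0
        else 1 / (of_int n ^ p * (real (a * m) + real b * of_int n) ^ q)) \<longlonglongrightarrow> f m) \<and>
      (\<lambda>m. f (Suc m) / real (Suc m) ^ r) sums x \<and> clausen_span k N x"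
proof (induction "p + q" arbitrary: p q r rule: less_induct)
  case less
  have s0: "int (a * m) + int b * n = 0 \<longleftrightarrow> real (a * m) + real b * of_int n = 0" for m n
  proof -
    have "real (a * m) + real b * of_int n = of_int (int (a * m) + int b * n)" by simp
    then show ?thesis by (simp only: of_int_eq_0_iff)
  qed
  consider "q = 0" "p > 0" "r \<ge> 2" | "p = 0" "q > 0" "r \<ge> 2" | p' q' where "p = Suc p'" "q = Suc q'"
    using less.prems by (cases p; cases q) auto
  then show ?case
  proof cases
    case 1
    obtain t where t: "t \<in> \<rat>" "odd p \<Longrightarrow> t = 0"
      "(\<lambda>M. \<Sum>n\<in>{-int M..<int M}. 1 / (of_int n) ^ p) \<longlonglongrightarrow> pi ^ p * t"
      using symmetric_sum_0[OF 1(2)] by blast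
    have "trig_span b (even p) (\<lambda>_. t)"
      using t by (cases "even p") (auto intro: trig_span_const trig_span_zero)
    from trig_span_sums_clausen[OF this assms(2-5), of p r] obtain x where
      x: "(\<lambda>m. t / real (Suc m) ^ r) sums x" "clausen_span k N (pi ^ p * x)"
      using 1 less.prems by auto
    from trig_span_sums_clausen[OF dvd_indicator_trig_span[OF assms(2)] assms(2-5), of 0 k a] obtain y where
      y: "(\<lambda>m. (if b dvd a * Suc m then 1 else 0) / real (Suc m) ^ k) sums y" "clausen_span k N y"
      using 1 less.prems by auto
    \<comment> \<open>The term \<open>n = 0\<close> already counts as 0. The subtracted term is the
      one at n = -am/b, present only if \<open>b dvd a * m\<close>; it yields \<open>y\<close>, of
      full weight \<open>k\<close>.\<close>
    define f where "f = (\<lambda>m. pi ^ p * t - (- real b / real a) ^ p * ((if b dvd a * m then 1 else 0) / real m ^ p))"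
    have lim: "(\<lambda>M. \<Sum>n\<in>{-int M..<int M}.
        if n = 0 \<or> int (a * m) + int b * n = 0 then 0
        else 1 / (of_int n ^ p * (real (a * m) + real b * of_int n) ^ q)) \<longlonglongrightarrow> f m" if "m > 0" for m
    proof (cases "b dvd a * m")
      case True
      then obtain i where i: "a * m = b * i" by blast
      have "(\<lambda>M. \<Sum>n\<in>{-int M..<int M}. if n = - int i then 0 else 1 / (of_int n) ^ p)
          \<longlonglongrightarrow> pi ^ p * t - 1 / (of_int (- int i)) ^ p"
        by (rule symmetric_sum_remove[OF t(3)])
      moreover have "(if n = 0 \<or> int (a * m) + int b * n = 0 then 0
          else 1 / (of_int n ^ p * (real (a * m) + real b * of_int n) ^ q))
          = (if n = - int i then 0 else 1 / (of_int n :: real) ^ p)" for n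
      proof -
        have "int (a * m) + int b * n = int b * (n + int i)"
          by (simp add: i algebra_simps)
        then have "int (a * m) + int b * n = 0 \<longleftrightarrow> n = - int i"
          using assms by auto
        then show ?thesis using 1 by auto
      qed
      moreover have "1 / (of_int (- int i)) ^ p = (- real b / real a) ^ p * (1 / real m ^ p)"
      proof -
        have "real a * real m = real b * real i"
          using i by (metis of_nat_mult)
        then have "real i = real a * real m / real b"
          using assms by (simp add: field_simps)
        then have "1 / of_int (- int i) = (- real b / real a) * (1 / real m)"
          using assms that by simp
        then have "(1 / of_int (- int i)) ^ p = ((- real b / real a) * (1 / real m)) ^ p"
          by (simp only:)
        then show ?thesis
          by (simp only: power_mult_distrib power_one_over)
      qed
      ultimately show ?thesis by (simp add: f_def True)
    next
      case False
      have "int (a * m) + int b * n \<noteq> 0" for n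
      proof
        assume "int (a * m) + int b * n = 0"
        then have "int (a * m) = int b * (- n)" by simp
        then have "int b dvd int (a * m)" by (rule dvdI)
        then show False using False int_dvd_int_iff by blast
      qed
      then have "(if n = 0 \<or> int (a * m) + int b * n = 0 then 0
          else 1 / (of_int n ^ p * (real (a * m) + real b * of_int n) ^ q)) = 1 / (of_int n :: real) ^ p" for n
        using 1 by auto
      then show ?thesis using t(3) by (simp add: f_def False)
    qed
    have "(\<lambda>m. pi ^ p * (t / real (Suc m) ^ r) - (- real b / real a) ^ p *
        ((if b dvd a * Suc m then 1 else 0) / real (Suc m) ^ k)) sums (pi ^ p * x - (- real b / real a) ^ p * y)"
      by (intro sums_diff sums_mult x y)
    moreover have "k = r + p" using 1 less.prems by simp
    then have "pi ^ p * (t / real (Suc m) ^ r) - (- real b / real a) ^ p *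
        ((if b dvd a * Suc m then 1 else 0) / real (Suc m) ^ k) = f (Suc m) / real (Suc m) ^ r" for m
      by (simp add: f_def diff_divide_distrib power_add mult.commute del: of_nat_Suc mult_Suc_right)
    ultimately have "(\<lambda>m. f (Suc m) / real (Suc m) ^ r) sums (pi ^ p * x - (- real b / real a) ^ p * y)"
      by (simp only:)
    moreover have "clausen_span k N (pi ^ p * x - (- real b / real a) ^ p * y)"
      by (intro clausen_span_diff x clausen_span_scale[OF y(2)]) auto
    ultimately show ?thesis using lim by blast
  next
    case 2
    obtain g where g: "trig_span b (even q) g"
      "\<And>c. (\<lambda>M. \<Sum>n\<in>{-int M..<int M}. 1 / (real c + real b * of_int n) ^ q) \<longlonglongrightarrow> pi ^ q * g c"
      using symmetric_sum_progression[OF assms(2) 2(2)] by blast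
    from trig_span_sums_clausen[OF g(1) assms(2-5), of q r a] obtain x where
      x: "(\<lambda>m. g (a * Suc m) / real (Suc m) ^ r) sums x" "clausen_span k N (pi ^ q * x)"
      using 2 less.prems by auto
    from trig_span_sums_clausen[OF trig_span_const[of 1] assms(2-5), of 0 k] obtain y where
      y: "(\<lambda>m. 1 / real (Suc m) ^ k) sums y" "clausen_span k N y"
      using 2 less.prems by auto
    \<comment> \<open>Here the zero of am + bn already counts as 0, and the term
      \<open>n = 0\<close>, equal to 1/(am)^q, is subtracted. Its sum over \<open>m\<close> is a
      multiple of \<open>y\<close> = \<zeta>(k).\<close>
    define f where "f = (\<lambda>m. pi ^ q * g (a * m) - (1 / real a ^ q) * (1 / real m ^ q))"
    have lim: "(\<lambda>M. \<Sum>n\<in>{-int M..<int M}.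
        if n = 0 \<or> int (a * m) + int b * n = 0 then 0
        else 1 / (of_int n ^ p * (real (a * m) + real b * of_int n) ^ q)) \<longlonglongrightarrow> f m" for m
    proof -
      have "(if n = 0 \<or> int (a * m) + int b * n = 0 then 0
          else 1 / (of_int n ^ p * (real (a * m) + real b * of_int n) ^ q))
          = (if n = 0 then 0 else 1 / (real (a * m) + real b * of_int n) ^ q)" for n
        unfolding s0 using 2 by simp
      then show ?thesis
        using symmetric_sum_remove[OF g(2)[of "a * m"], of 0] by (simp add: f_def power_mult_distrib)
    qed
    have "(\<lambda>m. pi ^ q * (g (a * Suc m) / real (Suc m) ^ r) - (1 / real a ^ q) * (1 / real (Suc m) ^ k))
        sums (pi ^ q * x - (1 / real a ^ q) * y)"
      by (intro sums_diff sums_mult x y)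
    moreover have "k = r + q" using 2 less.prems by simp
    then have "pi ^ q * (g (a * Suc m) / real (Suc m) ^ r) - (1 / real a ^ q) * (1 / real (Suc m) ^ k)
        = f (Suc m) / real (Suc m) ^ r" for m
      by (simp add: f_def diff_divide_distrib power_add mult.commute del: of_nat_Suc mult_Suc_right)
    ultimately have "(\<lambda>m. f (Suc m) / real (Suc m) ^ r) sums (pi ^ q * x - (1 / real a ^ q) * y)"
      by (simp only:)
    moreover have "clausen_span k N (pi ^ q * x - (1 / real a ^ q) * y)"
      by (intro clausen_span_diff x clausen_span_scale[OF y(2)]) auto
    ultimately show ?thesis using lim by blast
  next
    case 3
    define T where "T = (\<lambda>p q m n. if n = 0 \<or> int (a * m) + int b * n = 0 then 0
        else 1 / (of_int n ^ p * (real (a * m) + real b * of_int n) ^ q))"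
    have "\<exists>f x. (\<forall>m>0. (\<lambda>M. \<Sum>n\<in>{-int M..<int M}. T p q' m n) \<longlonglongrightarrow> f m) \<and>
      (\<lambda>m. f (Suc m) / real (Suc m) ^ Suc r) sums x \<and> clausen_span k N x"
      unfolding T_def by (rule less.hyps) (use 3 less.prems in auto)
    then obtain f1 x1 where 1: "\<And>m. m > 0 \<Longrightarrow> (\<lambda>M. \<Sum>n\<in>{-int M..<int M}. T p q' m n) \<longlonglongrightarrow> f1 m"
      "(\<lambda>m. f1 (Suc m) / real (Suc m) ^ Suc r) sums x1" "clausen_span k N x1"
      by blast
    have "\<exists>f x. (\<forall>m>0. (\<lambda>M. \<Sum>n\<in>{-int M..<int M}. T p' q m n) \<longlonglongrightarrow> f m) \<and>
      (\<lambda>m. f (Suc m) / real (Suc m) ^ Suc r) sums x \<and> clausen_span k N x"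
      unfolding T_def by (rule less.hyps) (use 3 less.prems in auto)
    then obtain f2 x2 where 2: "\<And>m. m > 0 \<Longrightarrow> (\<lambda>M. \<Sum>n\<in>{-int M..<int M}. T p' q m n) \<longlonglongrightarrow> f2 m"
      "(\<lambda>m. f2 (Suc m) / real (Suc m) ^ Suc r) sums x2" "clausen_span k N x2"
      by blast
    \<comment> \<open>Since \<open>T\<close> vanishes at the excluded points for all exponents, the
      partial fraction identity holds there too.\<close>
    have T: "T p q m n = (1 / real a) * (1 / real m) * (T p q' m n - real b * T p' q m n)" if "m > 0" for m n
    proof (cases "n = 0 \<or> int (a * m) + int b * n = 0")
      case False
      define u where "u = (of_int n :: real)"
      define s where "s = real (a * m) + real b * u"
      have nz: "u \<noteq> 0" "s \<noteq> 0" "real a * real m = s - real b * u" "s - real b * u \<noteq> 0"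
        using False s0[of m n] that assms by (auto simp: u_def s_def)
      have "T p q m n = 1 / (u ^ p * s ^ q)" "T p q' m n = 1 / (u ^ p * s ^ q')" "T p' q m n = 1 / (u ^ p' * s ^ q)"
        using False by (simp_all add: T_def u_def s_def)
      moreover have "1 / (u ^ p * s ^ q) = (1 / (s - real b * u)) * (1 / (u ^ p * s ^ q') - real b * (1 / (u ^ p' * s ^ q)))"
        unfolding 3 using nz by (simp add: field_simps)
      ultimately show ?thesis
        by (simp add: nz(3)[symmetric])
    qed (auto simp: T_def)
    define f where "f = (\<lambda>m. (1 / real a) * (1 / real m) * (f1 m - real b * f2 m))"
    have lim: "(\<lambda>M. \<Sum>n\<in>{-int M..<int M}. T p q m n) \<longlonglongrightarrow> f m" if "m > 0" for m
      unfolding T[OF that] f_def sum_distrib_left[symmetric] sum_subtractf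
      by (intro tendsto_intros 1 2 that)
    have "(\<lambda>m. (1 / real a) * (f1 (Suc m) / real (Suc m) ^ Suc r - real b * (f2 (Suc m) / real (Suc m) ^ Suc r)))
        sums ((1 / real a) * (x1 - real b * x2))"
      by (intro sums_mult sums_diff 1 2)
    moreover have "(1 / real a) * (f1 (Suc m) / real (Suc m) ^ Suc r - real b * (f2 (Suc m) / real (Suc m) ^ Suc r))
        = f (Suc m) / real (Suc m) ^ r" for m
      by (simp add: f_def diff_divide_distrib mult_ac del: of_nat_Suc)
    ultimately have "(\<lambda>m. f (Suc m) / real (Suc m) ^ r) sums ((1 / real a) * (x1 - real b * x2))"
      by (simp only:)
    moreover have "clausen_span k N ((1 / real a) * (x1 - real b * x2))"
      by (intro clausen_span_diff clausen_span_scale 1 2) auto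
    ultimately show ?thesis
      using lim unfolding T_def by blast
  qed
qed

section \<open>Summation over half planes\<close>

lemma summable_on_inj_scale:
  fixes G :: "'a \<Rightarrow> real"
  assumes "h summable_on B" "inj_on \<phi> A" "\<phi> ` A \<subseteq> B" "\<And>x. x \<in> A \<Longrightarrow> G x = c * h (\<phi> x)"
  shows "G summable_on A"
proof -
  have "h summable_on (\<phi> ` A)"
    using assms(1,3) by (rule summable_on_subset_banach)
  then have "(\<lambda>x. h (\<phi> x)) summable_on A"
    using summable_on_reindex[OF assms(2), of h] by (simp add: o_def)
  then have "(\<lambda>x. c * h (\<phi> x)) summable_on A"
    by (rule summable_on_cmult_right)
  then show ?thesis
    using assms(4) by (simp cong: summable_on_cong)
qed

definition zeta_term :: "nat \<Rightarrow> nat \<Rightarrow> nat \<Rightarrow> nat \<Rightarrow> nat \<Rightarrow> int \<times> int \<Rightarrow> real" where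
  "zeta_term a b k1 k2 k3 = (\<lambda>(m, n). 1 / (of_int m ^ k1 * of_int n ^ k2 * of_int (int a * m + int b * n) ^ k3))"

text \<open>In the quadrant \<open>m > 0 > n\<close>, solving for the largest of \<open>am\<close>, \<open>-bn\<close> and \<open>|am + bn|\<close> embeds the sum
  into a series of the type \<open>\<zeta>\<^bsub>b,1\<^esub>\<close> or \<open>\<zeta>\<^bsub>a,1\<^esub>\<close>.\<close>

lemma zeta_term_summable:
  assumes pos: "a > 0" "b > 0" "k1 > 0" "k2 > 0" "k3 > 0"
  shows "zeta_term a b k1 k2 k3 summable_on {0<..} \<times> UNIV" (is "?G summable_on _")
proof -
  define P where "P = {0<..} \<times> {0<..} \<union> {(m, n). 0 < m \<and> n < 0 \<and> 0 < int a * m + int b * n}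
      \<union> {(m, n). 0 < m \<and> n < 0 \<and> int a * m + int b * n < 0}"
  have "?G summable_on {0<..} \<times> {0<..}"
    by (rule summable_on_inj_scale[OF zeta_ab_summable[OF pos], of "\<lambda>(m, n). (nat m, nat n)" _ _ 1])
       (auto simp: inj_on_def zeta_term_def)
  moreover have "?G summable_on {(m, n). 0 < m \<and> n < 0 \<and> 0 < int a * m + int b * n}"
  \<comment> \<open>With u = -n and s = am + bn one has am = bu + s, so 1/m^k1 = a^k1/(bu + s)^k1;
    the sign comes from n = -u.\<close>
  proof (rule summable_on_inj_scale[OF zeta_ab_summable[of b 1 k2 k3 k1],
        of "\<lambda>(m, n). (nat (- n), nat (int a * m + int b * n))" _ _ "(-1) ^ k2 * real a ^ k1"])
    show "inj_on (\<lambda>(m, n). (nat (- n), nat (int a * m + int b * n)))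
        {(m, n). 0 < m \<and> n < 0 \<and> 0 < int a * m + int b * n}"
      using pos by (auto simp: inj_on_def eq_nat_nat_iff)
  next
    fix x assume "x \<in> {(m, n). 0 < m \<and> n < 0 \<and> 0 < int a * m + int b * n}"
    then obtain m n where x: "x = (m, n)" and mn: "0 < m" "n < 0" "0 < int a * m + int b * n"
      by auto
    define s where "s = int a * m + int b * n"
    have nat_b: "real (b * nat (- n) + 1 * nat s) = real a * of_int m"
      using mn by (simp add: s_def algebra_simps)
    have "real (nat s) = of_int s" "real (nat (- n)) = - of_int n"
      using mn by (simp_all add: s_def)
    moreover have "(- of_int n :: real) ^ k2 = (-1) ^ k2 * of_int n ^ k2"
      by (simp flip: power_mult_distrib)
    ultimately show "?G x = (-1) ^ k2 * real a ^ k1 * (case case x of (m, n) \<Rightarrow> (nat (- n), nat (int a * m + int b * n)) of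
        (m, n) \<Rightarrow> 1 / (real m ^ k2 * real n ^ k3 * real (b * m + 1 * n) ^ k1))"
      using pos unfolding x prod.case s_def[symmetric] nat_b zeta_term_def by (simp add: power_mult_distrib)
  qed (use pos in auto)
  moreover have "?G summable_on {(m, n). 0 < m \<and> n < 0 \<and> int a * m + int b * n < 0}"
  \<comment> \<open>With s = am + bn negative, -bn = am + (-s) replaces the factor in
    \<open>n\<close>, at the cost of \<open>b ^ k2\<close> and the signs of \<open>n\<close> and
    s.\<close>
  proof (rule summable_on_inj_scale[OF zeta_ab_summable[of a 1 k1 k3 k2],
        of "\<lambda>(m, n). (nat m, nat (- (int a * m + int b * n)))" _ _ "(-1) ^ k2 * (-1) ^ k3 * real b ^ k2"])
    show "inj_on (\<lambda>(m, n). (nat m, nat (- (int a * m + int b * n))))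
        {(m, n). 0 < m \<and> n < 0 \<and> int a * m + int b * n < 0}"
      using pos by (auto simp: inj_on_def eq_nat_nat_iff)
  next
    fix x assume "x \<in> {(m, n). 0 < m \<and> n < 0 \<and> int a * m + int b * n < 0}"
    then obtain m n where x: "x = (m, n)" and mn: "0 < m" "n < 0" "int a * m + int b * n < 0"
      by auto
    define s where "s = int a * m + int b * n"
    have nat_a: "real (a * nat m + 1 * nat (- s)) = - (real b * of_int n)"
      using mn by (simp add: s_def algebra_simps)
    have "real (nat (- s)) = - of_int s" "real (nat m) = of_int m"
      using mn by (simp_all add: s_def)
    moreover have "(- of_int s :: real) ^ k3 = (-1) ^ k3 * of_int s ^ k3"
      "(- (real b * of_int n)) ^ k2 = (-1) ^ k2 * real b ^ k2 * of_int n ^ k2"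
      by (simp_all flip: power_mult_distrib)
    ultimately show "?G x = (-1) ^ k2 * (-1) ^ k3 * real b ^ k2 * (case case x of (m, n) \<Rightarrow> (nat m, nat (- (int a * m + int b * n))) of
        (m, n) \<Rightarrow> 1 / (real m ^ k1 * real n ^ k3 * real (a * m + 1 * n) ^ k2))"
      using pos unfolding x prod.case s_def[symmetric] nat_a zeta_term_def by simp
  qed (use pos in auto)
  ultimately have "?G summable_on P"
    unfolding P_def by (intro summable_on_Un_disjoint) auto
  \<comment> \<open>The points outside \<open>P\<close> have \<open>n = 0\<close> or am + bn = 0,
    where the term is 0.\<close>
  then show ?thesis
    by (rule summable_on_cong_neutral[THEN iffD1, rotated -1])
       (use pos in \<open>auto simp: P_def zeta_term_def simp del: of_int_add of_int_mult\<close>)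
qed

text \<open>The intervals eventually contain every finite set of integers, so they are cofinal for
  unconditional summation.\<close>

lemma has_sum_int_tendsto:
  assumes "(f has_sum (s :: real)) (UNIV :: int set)"
  shows "(\<lambda>M. \<Sum>n\<in>{-int M..<int M}. f n) \<longlonglongrightarrow> s"
proof -
  have "filterlim (\<lambda>M. {-int M..<int M}) (finite_subsets_at_top UNIV) sequentially"
    unfolding filterlim_finite_subsets_at_top
  proof (intro allI impI)
    fix X :: "int set" assume X: "finite X \<and> X \<subseteq> UNIV"
    define K where "K = Max (insert 0 (abs ` X))"
    have K: "\<bar>x\<bar> \<le> K" if "x \<in> X" for x
      unfolding K_def using X that by (intro Max_ge) auto
    show "\<forall>\<^sub>F M in sequentially. finite {-int M..<int M} \<and> X \<subseteq> {-int M..<int M} \<and> {-int M..<int M} \<subseteq> UNIV"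
      using eventually_gt_at_top[of "nat K"]
    proof eventually_elim
      case (elim M)
      show ?case
      proof (intro conjI subsetI)
        fix x assume "x \<in> X"
        from K[OF this] elim show "x \<in> {-int M..<int M}" by auto
      qed auto
    qed
  qed
  then show ?thesis
    using assms unfolding has_sum_def by (rule filterlim_compose[rotated])
qed

text \<open>Summability over the half plane allows summing row by row, and each row sum equals its
  symmetric limit. In that form partial fractions apply, although their pieces may converge only
  conditionally.\<close>

lemma zeta_term_half_plane_clausen:
  assumes pos: "a > 0" "b > 0" "k1 > 0" "k2 > 0" "k3 > 0" and "odd k" "k = k1 + k2 + k3" "b dvd N" "N > 0"
  shows "\<exists>x. (zeta_term a b k1 k2 k3 has_sum x) ({0<..} \<times> UNIV) \<and> clausen_span k N x"
proof -
  have "\<exists>f x. (\<forall>m>0. (\<lambda>M. \<Sum>n\<in>{-int M..<int M}.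
        if n = 0 \<or> int (a * m) + int b * n = 0 then 0
        else 1 / (of_int n ^ k2 * (real (a * m) + real b * of_int n) ^ k3)) \<longlonglongrightarrow> f m) \<and>
      (\<lambda>m. f (Suc m) / real (Suc m) ^ k1) sums x \<and> clausen_span k N x"
    by (rule partial_fraction_clausen) (use assms in auto)
  then obtain f x where f: "\<And>m. m > 0 \<Longrightarrow> (\<lambda>M. \<Sum>n\<in>{-int M..<int M}.
        if n = 0 \<or> int (a * m) + int b * n = 0 then 0
        else 1 / (of_int n ^ k2 * (real (a * m) + real b * of_int n) ^ k3)) \<longlonglongrightarrow> f m"
    and x: "(\<lambda>m. f (Suc m) / real (Suc m) ^ k1) sums x" "clausen_span k N x"
    by blast
  define G where "G = zeta_term a b k1 k2 k3"
  have summable: "G summable_on {0<..} \<times> UNIV"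
    unfolding G_def by (rule zeta_term_summable[OF pos])
  define g where "g = (\<lambda>m. infsum (\<lambda>n. G (m, n)) UNIV)"
  have fiber: "((\<lambda>n. G (m, n)) has_sum g m) UNIV" if "m \<in> {0<..}" for m
    unfolding g_def using summable that
    by (intro has_sum_infsum summable_on_SigmaD1[where f = "\<lambda>m n. G (m, n)" and A = "{0<..}"]) auto
  have "(g has_sum infsum G ({0<..} \<times> UNIV)) {0<..}"
    by (rule has_sum_SigmaD[OF has_sum_infsum[OF summable] fiber])
  then have "((\<lambda>m. g (int (Suc m))) has_sum infsum G ({0<..} \<times> UNIV)) UNIV"
    by (subst has_sum_reindex_bij_witness[where i = "\<lambda>m. nat m - 1" and j = "\<lambda>m. int (Suc m)"
          and T = "{0<..}" and h = g]) auto
  then have "(\<lambda>m. g (int (Suc m))) sums infsum G ({0<..} \<times> UNIV)"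
    by (rule has_sum_imp_sums)
  moreover have "g (int (Suc m)) = f (Suc m) / real (Suc m) ^ k1" for m
  \<comment> \<open>Both sides are limits of the same symmetric partial sums of the row
    \<open>Suc m\<close>.\<close>
  proof (rule LIMSEQ_unique)
    show "(\<lambda>M. \<Sum>n\<in>{-int M..<int M}. G (int (Suc m), n)) \<longlonglongrightarrow> g (int (Suc m))"
      by (intro has_sum_int_tendsto fiber) auto
    have "(\<lambda>M. (1 / real (Suc m) ^ k1) * (\<Sum>n\<in>{-int M..<int M}.
        if n = 0 \<or> int (a * Suc m) + int b * n = 0 then 0
        else 1 / (of_int n ^ k2 * (real (a * Suc m) + real b * of_int n) ^ k3)))
        \<longlonglongrightarrow> (1 / real (Suc m) ^ k1) * f (Suc m)"
      by (intro tendsto_intros f) auto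
    moreover have "(1 / real (Suc m) ^ k1) * (if n = 0 \<or> int (a * Suc m) + int b * n = 0 then 0
        else 1 / (of_int n ^ k2 * (real (a * Suc m) + real b * of_int n) ^ k3)) = G (int (Suc m), n)" for n
    proof (cases "n = 0 \<or> int (a * Suc m) + int b * n = 0")
      case True
      then have "n = 0 \<or> int a * int (Suc m) + int b * n = 0" by (simp add: distrib_left)
      then have "of_int n ^ k2 * of_int (int a * int (Suc m) + int b * n) ^ k3 = (0 :: real)"
        using pos by (auto simp only: mult_eq_0_iff power_eq_0_iff of_int_eq_0_iff)
      then have "G (int (Suc m), n) = 0"
        unfolding G_def zeta_term_def prod.case mult.assoc by (simp only: mult_zero_right div_by_0)
      with True show ?thesis by (simp only: if_True mult_zero_right)
    next
      case False
      have "of_int (int a * int (Suc m) + int b * n) = real (a * Suc m) + real b * of_int n"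
        by (simp add: distrib_left)
      then show ?thesis using False
        by (simp add: G_def zeta_term_def mult.assoc del: of_nat_Suc mult_Suc_right of_int_add of_int_mult of_nat_mult)
    qed
    ultimately show "(\<lambda>M. \<Sum>n\<in>{-int M..<int M}. G (int (Suc m), n)) \<longlonglongrightarrow> f (Suc m) / real (Suc m) ^ k1"
      unfolding sum_distrib_left by (simp only: times_divide_eq_left mult_1_left)
  qed
  ultimately have "(\<lambda>m. f (Suc m) / real (Suc m) ^ k1) sums infsum G ({0<..} \<times> UNIV)"
    by (simp only:)
  with x(1) have "x = infsum G ({0<..} \<times> UNIV)"
    by (rule sums_unique2)
  then have "(G has_sum x) ({0<..} \<times> UNIV)"
    using has_sum_infsum[OF summable] by simp
  then show ?thesis using x(2) unfolding G_def by blast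
qed

section \<open>Combining the two half planes\<close>

theorem theorem1p1:
  fixes a b k1 k2 k3 k N :: nat
  assumes "a > 0" and "b > 0" and "k1 > 0" and "k2 > 0" and "k3 > 0"
    and "N = lcm a b" and "k = k1 + k2 + k3" and "odd k"
  shows "\<exists>p q :: nat \<Rightarrow> nat \<Rightarrow> rat.
    zeta_ab a b k1 k2 k3 =
      (\<Sum>n = 0..(k - 3) div 2. \<Sum>d = 0..<N.
          of_rat (p n d) * (pi ^ (2 * n) * clausen_C (k - 2 * n) (real d / real N))
        + of_rat (q n d) * (pi ^ (2 * n + 1) * clausen_S (k - 2 * n - 1) (real d / real N)))"
proof (rule clausen_span_explicit)
  note pos = assms(1-5)
  show N: "N > 0"
    using assms by (simp add: lcm_pos_nat)
  define G where "G = zeta_term a b k1 k2 k3"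
  \<comment> \<open>The term is homogeneous of degree \<open>- k\<close>, and \<open>k\<close> is
    odd.\<close>
  have odd: "G (- m, - n) = - G (m, n)" for m n
  proof -
    have "(- of_int m :: real) ^ k1 * (- of_int n) ^ k2 * (- of_int (int a * m + int b * n)) ^ k3
        = (- 1) ^ k * (of_int m ^ k1 * of_int n ^ k2 * of_int (int a * m + int b * n) ^ k3)"
      unfolding assms(7) power_add
      by (subst (1 2 3) power_minus) (simp only: mult_ac)
    moreover have "int a * - m + int b * - n = - (int a * m + int b * n)"
      by simp
    ultimately show ?thesis
      using assms(8) unfolding G_def zeta_term_def prod.case by (simp only: of_int_minus) simp
  qed
  \<comment> \<open>This half plane uses \<open>b dvd N\<close>, the next one, with the roles of
    \<open>a\<close> and \<open>b\<close> exchanged, uses \<open>a dvd N\<close>; the least common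
    multiple serves both.\<close>
  obtain x where x: "(G has_sum x) ({0<..} \<times> UNIV)" "clausen_span k N x"
    using zeta_term_half_plane_clausen[OF pos assms(8,7), of N] N assms(6) unfolding G_def by auto
  obtain y where y: "(zeta_term b a k2 k1 k3 has_sum y) ({0<..} \<times> UNIV)" "clausen_span k N y"
    using zeta_term_half_plane_clausen[of b a k2 k1 k3 k N] pos assms(6-8) N by auto
  have "(zeta_term b a k2 k1 k3) = (\<lambda>(n, m). G (m, n))"
    by (auto simp: G_def zeta_term_def fun_eq_iff add.commute mult_ac)
  then have y': "(G has_sum y) (UNIV \<times> {0<..})"
    using y(1) by (subst has_sum_swap) simp
  have summable: "G summable_on {0<..} \<times> UNIV"
    using x by (auto simp: summable_on_def)
  obtain P where P: "(G has_sum P) ({0<..} \<times> {0<..})"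
    using summable_on_subset_banach[OF summable, of "{0<..} \<times> {0<..}"] by (auto simp: summable_on_def)
  obtain w where w: "(G has_sum w) ({0<..} \<times> {..<0})"
    using summable_on_subset_banach[OF summable, of "{0<..} \<times> {..<0}"] by (auto simp: summable_on_def)
  \<comment> \<open>The point reflection at the origin maps one mixed quadrant onto the other and
    reverses the sign of \<open>G\<close>.\<close>
  have w': "(G has_sum - w) ({..<0} \<times> {0<..})"
  proof -
    have "((\<lambda>p. - G p) has_sum - w) ({0<..} \<times> {..<0})"
      using w by (simp add: has_sum_uminus)
    then show ?thesis
      by (subst has_sum_reindex_bij_witness[where i = "\<lambda>(m, n). (- m, - n)" and j = "\<lambda>(m, n). (- m, - n)"
            and T = "{0<..} \<times> {..<0}" and h = "\<lambda>p. - G p"]) (auto simp: odd)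
  qed
  have "(G has_sum (P + w)) ({0<..} \<times> {0<..} \<union> {0<..} \<times> {..<0})"
    by (rule has_sum_Un_disjoint[OF P w]) auto
  \<comment> \<open>The axis \<open>n = 0\<close> contributes nothing because \<open>k2 > 0\<close>
    and \<open>1 / 0 = 0\<close>.\<close>
  then have "(G has_sum (P + w)) ({0<..} \<times> UNIV)"
    by (rule has_sum_cong_neutral[THEN iffD1, rotated -1])
       (use pos in \<open>auto simp: G_def zeta_term_def\<close>)
  then have 1: "x = P + w"
    using x(1) has_sum_unique by blast
  have "(G has_sum (P + - w)) ({0<..} \<times> {0<..} \<union> {..<0} \<times> {0<..})"
    by (rule has_sum_Un_disjoint[OF P w']) auto
  then have "(G has_sum (P + - w)) (UNIV \<times> {0<..})"
    by (rule has_sum_cong_neutral[THEN iffD1, rotated -1])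
       (use pos in \<open>auto simp: G_def zeta_term_def\<close>)
  then have 2: "y = P - w"
    using y' has_sum_unique by fastforce
  have "((\<lambda>(m, n). 1 / (real m ^ k1 * real n ^ k2 * real (a * m + b * n) ^ k3)) has_sum P) ({0<..} \<times> {0<..})"
    using P
    by (subst has_sum_reindex_bij_witness[where i = "\<lambda>(m, n). (nat m, nat n)" and j = "\<lambda>(m, n). (int m, int n)"
          and T = "{0<..} \<times> {0<..}" and h = G]) (auto simp: G_def zeta_term_def)
  then have "zeta_ab a b k1 k2 k3 = P"
    unfolding zeta_ab_def by (rule infsumI)
  also have "P = (1 / 2) * (x + y)"
    using 1 2 by simp
  finally have eq: "zeta_ab a b k1 k2 k3 = (1 / 2) * (x + y)" .
  show "clausen_span k N (zeta_ab a b k1 k2 k3)"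
    unfolding eq by (intro clausen_span_scale clausen_span.add x y) auto
qed

end
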